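(* There are absolute constants $k_0\in\mathbb N$ and $\alpha,\varepsilon>0$ such that for all integers $d\ge k\ge k_0$ and every $n\ge \alpha d^8k^6$ there is a pair of $k$-ary relational structures $\mathfrak A$ and $\mathfrak B$ with $|V(\mathfrak A)|=|V(\mathfrak B)|=n$ that are distinguished by $k$-WL, but $d$-WL does not distinguish $\mathfrak A$ and $\mathfrak B$ after $n^{\varepsilon k}$ refinement rounds.
   Context: A relational structure $\mathfrak A$ of arity at most $k$ consists of a finite universe $V(\mathfrak A)$ and relations $R_i^{\mathfrak A}\subseteq V(\mathfrak A)^{k_i}$ with $k_i\le k$; a $k$-ary structure is one whose relations have arity at most $k$. For $\vec v=(v_1,\dots,v_m)\in V(\mathfrak A)^m$, the atomic type $\mathrm{atp}_{\mathfrak A}(\vec v)$ is the isomorphism type of the ordered induced substructure on $\{v_1,\dots,v_m\}$ (two tuples in possibly different structures have the same atomic type iff $v_i\mapsto w_i$ is a well-defined isomorphism of the induced substructures). For a coloring $\chi$ of $V^m$, its $m$-WL refinement is $\chi'(\vec v)=\big(\chi(\vec v),\{\!\{(\chi(\vec v[w/1]),\dots,\chi(\vec v[w/m]))\mid w\in V\}\!\}\big)$, where $\vec v[w/i]$ replaces the $i$-th entry by $w$. The $m$-WL algorithm (for structures of arity at most $m$) computes $\chi^{(0)}_{\mathfrak A}=\mathrm{atp}_{\mathfrak A}$ on $V(\mathfrak A)^m$ and $\chi^{(r+1)}_{\mathfrak A}=(\chi^{(r)}_{\mathfrak A})'$, with colors defined uniformly so they can be compared across structures. $m$-WL distinguishes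 $\mathfrak A$ and $\mathfrak B$ after $r$ rounds if for some color $c$ the numbers of tuples of color $c$ under $\chi^{(r)}_{\mathfrak A}$ and under $\chi^{(r)}_{\mathfrak B}$ differ; it distinguishes them if it does so after some number of rounds. *)

theory Defs
  imports Complex_Main "HOL-Library.Multiset"
begin

text \<open>A signature is the list of arities of its relation symbols \<open>R\<^sub>0, \<dots>, R\<^sub>l\<close>; tuples are lists.
  Values of \<open>rel\<close> at indices outside the signature are ignored by everything below.\<close>

type_synonym signature = "nat list"

record 'a rel_struct =
  univ :: "'a set"
  rel :: "nat \<Rightarrow> 'a list set"

definition tuples :: "'a set \<Rightarrow> nat \<Rightarrow> 'a list set" where
  "tuples V m = {v. length v = m \<and> set v \<subseteq> V}"

definition relational_structure :: "signature \<Rightarrow> 'a rel_struct \<Rightarrow> bool" where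
  "relational_structure \<sigma> A \<longleftrightarrow>
     finite (univ A) \<and> (\<forall>i<length \<sigma>. rel A i \<subseteq> tuples (univ A) (\<sigma> ! i))"

definition kary_structure :: "nat \<Rightarrow> signature \<Rightarrow> 'a rel_struct \<Rightarrow> bool" where
  "kary_structure k \<sigma> A \<longleftrightarrow> relational_structure \<sigma> A \<and> (\<forall>a\<in>set \<sigma>. a \<le> k)"

definition induced :: "'a rel_struct \<Rightarrow> 'a set \<Rightarrow> 'a rel_struct" where
  "induced A X = \<lparr>univ = X, rel = (\<lambda>i. {xs \<in> rel A i. set xs \<subseteq> X})\<rparr>"

definition is_iso :: "signature \<Rightarrow> ('a \<Rightarrow> 'b) \<Rightarrow> 'a rel_struct \<Rightarrow> 'b rel_struct \<Rightarrow> bool" where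
  "is_iso \<sigma> f A B \<longleftrightarrow> bij_betw f (univ A) (univ B) \<and>
     (\<forall>i<length \<sigma>. \<forall>xs\<in>tuples (univ A) (\<sigma> ! i). xs \<in> rel A i \<longleftrightarrow> map f xs \<in> rel B i)"

text \<open>The isomorphism type of the ordered induced substructure on the entries of \<open>v\<close> is encoded by
  pulling equality and all relations back to the positions of \<open>v\<close>. That this encodes exactly the
  isomorphism type is lemma \<open>atp_eq_iff\<close>.\<close>

type_synonym atomic_type = "(nat \<times> nat) set \<times> nat list set list"

definition atp :: "signature \<Rightarrow> 'a rel_struct \<Rightarrow> 'a list \<Rightarrow> atomic_type" where
  "atp \<sigma> A v =
     ({(i, j). i < length v \<and> j < length v \<and> v ! i = v ! j},
      map (\<lambda>s. {js \<in> tuples {..<length v} (\<sigma> ! s). map ((!) v) js \<in> rel A s}) [0..<length \<sigma>])"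

lemma atp_eq_iff:
  "atp \<sigma> A v = atp \<sigma> B w \<longleftrightarrow>
     (\<exists>f. map f v = w \<and> is_iso \<sigma> f (induced A (set v)) (induced B (set w)))"
proof
  assume eq: "atp \<sigma> A v = atp \<sigma> B w"
  let ?E = "\<lambda>v. {(i, j). i < length v \<and> j < length v \<and> v ! i = v ! j}"
  have E: "?E v = ?E w" using eq by (simp add: atp_def)
  have len: "length v = length w"
  proof -
    have "i < length v \<longleftrightarrow> i < length w" for i
    proof -
      have "(i, i) \<in> ?E v \<longleftrightarrow> (i, i) \<in> ?E w" by (simp only: E)
      then show ?thesis by simp
    qed
    from this[of "length v"] this[of "length w"] show ?thesis by linarith
  qed
  have eqv: "v ! i = v ! j \<longleftrightarrow> w ! i = w ! j" if "i < length v" "j < length v" for i j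
  proof -
    have "(i, j) \<in> ?E v \<longleftrightarrow> (i, j) \<in> ?E w" by (simp only: E)
    then show ?thesis using that len by simp
  qed
  have R: "map ((!) v) js \<in> rel A s \<longleftrightarrow> map ((!) w) js \<in> rel B s"
    if "s < length \<sigma>" "js \<in> tuples {..<length v} (\<sigma> ! s)" for s js
  proof -
    have "{js \<in> tuples {..<length v} (\<sigma> ! s). map ((!) v) js \<in> rel A s} =
          {js \<in> tuples {..<length w} (\<sigma> ! s). map ((!) w) js \<in> rel B s}"
      using eq that(1) by (simp add: atp_def)
    from eqset_imp_iff[OF this, of js] show ?thesis using that(2) len by simp
  qed
  define p where "p x = (SOME i. i < length v \<and> v ! i = x)" for x
  define f where "f x = w ! p x" for x
  have p: "p x < length v \<and> v ! p x = x" if "x \<in> set v" for x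
    unfolding p_def by (rule someI_ex) (use that in \<open>simp add: in_set_conv_nth\<close>)
  have fv: "f (v ! i) = w ! i" if "i < length v" for i
    using p[of "v ! i"] eqv[of "p (v ! i)" i] that unfolding f_def by simp
  have map: "map f v = w"
    by (rule nth_equalityI) (use len fv in auto)
  have inj: "inj_on f (set v)"
  proof (rule inj_onI)
    fix x y assume "x \<in> set v" "y \<in> set v" "f x = f y"
    then show "x = y" using p[of x] p[of y] eqv[of "p x" "p y"] unfolding f_def by simp
  qed
  have bij: "bij_betw f (set v) (set w)"
    using inj map by (auto simp: bij_betw_def)
  have rels: "xs \<in> rel A s \<longleftrightarrow> map f xs \<in> rel B s"
    if "s < length \<sigma>" "xs \<in> tuples (set v) (\<sigma> ! s)" for s xs
  proof -
    have "map ((!) v) (map p xs) = xs"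
      using that(2) p by (auto simp: tuples_def intro!: map_idI)
    moreover have "map ((!) w) (map p xs) = map f xs" by (simp add: f_def)
    moreover have "map p xs \<in> tuples {..<length v} (\<sigma> ! s)"
      using that(2) p by (auto simp: tuples_def)
    ultimately show ?thesis using R[OF that(1)] by metis
  qed
  have sub: "set (map f xs) \<subseteq> set w" if "set xs \<subseteq> set v" for xs
    using that map by auto
  have "is_iso \<sigma> f (induced A (set v)) (induced B (set w))"
    using bij rels sub by (auto simp: is_iso_def induced_def tuples_def)
  then show "\<exists>f. map f v = w \<and> is_iso \<sigma> f (induced A (set v)) (induced B (set w))"
    using map by blast
next
  assume "\<exists>f. map f v = w \<and> is_iso \<sigma> f (induced A (set v)) (induced B (set w))"
  then obtain f where map: "map f v = w"
    and iso: "is_iso \<sigma> f (induced A (set v)) (induced B (set w))" by blast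
  have len: "length w = length v" using map by auto
  have w: "w ! i = f (v ! i)" if "i < length v" for i
    using map that by auto
  have inj: "inj_on f (set v)" using iso by (simp add: is_iso_def induced_def bij_betw_def)
  have E: "v ! i = v ! j \<longleftrightarrow> w ! i = w ! j" if "i < length v" "j < length v" for i j
    using that w inj by (metis inj_on_contraD nth_mem)
  have R: "map ((!) v) js \<in> rel A s \<longleftrightarrow> map ((!) w) js \<in> rel B s"
    if s: "s < length \<sigma>" and js: "js \<in> tuples {..<length v} (\<sigma> ! s)" for s js
  proof -
    have *: "map ((!) w) js = map f (map ((!) v) js)"
      using js w by (simp add: tuples_def subset_iff)
    have t: "map ((!) v) js \<in> tuples (set v) (\<sigma> ! s)"
      using js by (auto simp: tuples_def)
    have "set (map f (map ((!) v) js)) \<subseteq> set w"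
      using t map by (auto simp: tuples_def)
    then show ?thesis
      using iso s t unfolding * by (auto simp: is_iso_def induced_def tuples_def)
  qed
  show "atp \<sigma> A v = atp \<sigma> B w"
  proof -
    have "{(i, j). i < length v \<and> j < length v \<and> v ! i = v ! j} =
          {(i, j). i < length v \<and> j < length v \<and> w ! i = w ! j}"
      using E by blast
    moreover have "{js \<in> tuples {..<length v} (\<sigma> ! s). map ((!) v) js \<in> rel A s} =
          {js \<in> tuples {..<length v} (\<sigma> ! s). map ((!) w) js \<in> rel B s}" if "s < length \<sigma>" for s
      using R[OF that] by blast
    ultimately show ?thesis unfolding atp_def len by simp
  qed
qed

text \<open>Colors live in one type for all structures and all rounds, so that they can be compared across
  structures; \<open>Refined\<close> is the pairing of the old color with the multiset of color tuples.\<close>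

datatype wl_color =
  Atomic atomic_type
| Refined wl_color "wl_color list multiset"

definition wl_refine :: "nat \<Rightarrow> 'a set \<Rightarrow> ('a list \<Rightarrow> wl_color) \<Rightarrow> 'a list \<Rightarrow> wl_color" where
  "wl_refine m V \<chi> v =
     Refined (\<chi> v) (image_mset (\<lambda>w. map (\<lambda>i. \<chi> (v[i := w])) [0..<m]) (mset_set V))"

primrec wl :: "signature \<Rightarrow> nat \<Rightarrow> 'a rel_struct \<Rightarrow> nat \<Rightarrow> 'a list \<Rightarrow> wl_color" where
  "wl \<sigma> m A 0 = (\<lambda>v. Atomic (atp \<sigma> A v))"
| "wl \<sigma> m A (Suc r) = wl_refine m (univ A) (wl \<sigma> m A r)"

definition wl_distinguishes_after ::
    "signature \<Rightarrow> nat \<Rightarrow> nat \<Rightarrow> 'a rel_struct \<Rightarrow> 'b rel_struct \<Rightarrow> bool" where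
  "wl_distinguishes_after \<sigma> m r A B \<longleftrightarrow>
     (\<exists>c. card {v \<in> tuples (univ A) m. wl \<sigma> m A r v = c} \<noteq>
          card {v \<in> tuples (univ B) m. wl \<sigma> m B r v = c})"

definition wl_distinguishes ::
    "signature \<Rightarrow> nat \<Rightarrow> 'a rel_struct \<Rightarrow> 'b rel_struct \<Rightarrow> bool" where
  "wl_distinguishes \<sigma> m A B \<longleftrightarrow> (\<exists>r. wl_distinguishes_after \<sigma> m r A B)"

end

theory Submission
  imports Defs "HOL-Library.Z2" "HOL-Library.FuncSet" "HOL-Library.Function_Algebras"
begin

text \<open>The structures encode a linear system over the two-element field; the second one has a twisted
  right-hand side. Spoiler and Duplicator play on a deep layered circuit of XOR gates whose
  sources are \<open>0\<close> and whose sink is required to be \<open>1\<close>. Walking down from the sink along wrong values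
  needs only three pebbled vertices, so the structures are distinguished eventually. The wiring is
  chosen by counting such that, across every block of steps, sums of few values below and of few
  values above never coincide nontrivially. Duplicator can therefore answer \<open>0\<close> below some block
  and follow a correct run with output \<open>1\<close> above it, and has to lower this block only by about \<open>d\<close>
  blocks per round.

  To obtain \<open>n\<^bsup>\<Omega>(k)\<^esup>\<close> rounds, each of the \<open>n\<^bsup>\<Omega>(k)\<^esup>\<close> vertices of the circuit is replaced by the XOR of
  about \<open>k / 3\<close> out of \<open>n / 2\<close> variables along a bipartite expander (hardness condensation as in
  Berkholz and Nordstroem). By expansion, \<open>d\<close> pebbled variables determine only few circuit vertices,
  and the remaining ones can be set freely through unique neighbours.\<close>

section \<open>XOR structures and the game on linear systems\<close>

text \<open>Duplicator only ever translates values by some \<open>\<eta>\<close>, so the game asks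
  for an \<open>\<eta>\<close> that solves the twisted system on the pebbled variables; as a whole
  this system is unsolvable. In a fixed wiring, a sum of pebbled values below a block could equal a
  sum above it, and zeros below would then restrict the run above. In a random block each register
  receives a fresh row of m - 1 random bits, so a given coincidence with a given last register has
  probability at most 2^-(m-1). With m = n registers this beats the n^O(kd) choices of vertex sets
  once n exceeds a constant times (kd)^2. The condensation is limited by the arity: a gate joins up
  to three vertices, so degree 8D requires 24D <= k. Expansion 6D out of degree 8D leaves a factor
  (n/2)^(2D) in the union bound. It has to pay for about n^D circuit vertices and for d^(8D), which
  is the origin of d^8.\<close>

declare add_bit_eq_xor [simp del] mult_bit_eq_and [simp del]

lemma bit_add_self [simp]: "a + a = (0::bit)"
  by (cases a) simp_all

lemma bit_add_eq_0_iff [simp]: "a + b = 0 \<longleftrightarrow> a = (b::bit)"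
  by (cases a; cases b) simp_all

definition xor_sig :: "(nat list \<times> bit) list \<Rightarrow> signature" where
  "xor_sig cs = map (\<lambda>c. length (fst c)) cs"

text \<open>Element \<open>e\<close> stands for the variable \<open>e div 2\<close> with value \<open>e mod 2\<close>; if \<open>n\<close> is odd, the last
  element is padding. Each constraint \<open>(L, b)\<close> is one relation, which requires the sum over \<open>L\<close> to be
  \<open>0\<close> in the untwisted and \<open>b\<close> in the twisted structure.\<close>

definition xor_struct :: "nat \<Rightarrow> (nat list \<times> bit) list \<Rightarrow> bool \<Rightarrow> nat rel_struct" where
  "xor_struct n cs tw = \<lparr>univ = {..<n}, rel = (\<lambda>i.
     {es. set es \<subseteq> {..<n} \<and> map (\<lambda>e. e div 2) es = fst (cs ! i) \<and>
          (\<Sum>e\<leftarrow>es. of_nat e) = (if tw then snd (cs ! i) else 0)})\<rparr>"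

definition flip :: "nat \<Rightarrow> (nat \<Rightarrow> bit) \<Rightarrow> nat \<Rightarrow> nat" where
  "flip n \<eta> e = (if e div 2 < n div 2 \<and> \<eta> (e div 2) = 1 then (if even e then e + 1 else e - 1) else e)"

lemma xor_struct_univ [simp]: "univ (xor_struct n cs tw) = {..<n}"
  by (simp add: xor_struct_def)

lemma kary_xor_struct:
  assumes "\<And>L b. (L, b) \<in> set cs \<Longrightarrow> length L \<le> k"
  shows "kary_structure k (xor_sig cs) (xor_struct n cs tw)"
proof -
  have "rel (xor_struct n cs tw) i \<subseteq> tuples {..<n} (xor_sig cs ! i)"
    if "i < length (xor_sig cs)" for i
    using that by (auto simp: xor_struct_def xor_sig_def tuples_def dest: arg_cong[where f = length])
  then show ?thesis using assms
    by (auto simp: kary_structure_def relational_structure_def xor_sig_def)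
qed

lemma flip_div2 [simp]: "flip n \<eta> e div 2 = e div 2"
  by (auto simp: flip_def elim!: evenE oddE)

lemma flip_flip [simp]: "flip n \<eta> (flip n \<eta> e) = e"
  by (auto simp: flip_def elim!: evenE oddE)

lemma flip_lt_iff [simp]: "flip n \<eta> e < n \<longleftrightarrow> e < n"
  by (auto simp: flip_def elim!: evenE oddE)

lemma of_nat_flip: "e div 2 < n div 2 \<Longrightarrow> (of_nat (flip n \<eta> e) :: bit) = of_nat e + \<eta> (e div 2)"
  by (cases "\<eta> (e div 2)") (auto simp: flip_def elim!: evenE oddE)

lemma flip_eq_iff [simp]: "flip n \<eta> e = flip n \<eta> e' \<longleftrightarrow> e = e'"
  by (metis flip_flip)

lemma flip_cong: "\<eta> (e div 2) = \<eta>' (e div 2) \<Longrightarrow> flip n \<eta> e = flip n \<eta>' e"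
  by (simp add: flip_def)

text \<open>Translation adds the sum of \<open>\<eta>\<close> over \<open>L\<close> to the parity of
  a tuple, which is the difference between the right-hand sides \<open>0\<close> and
  \<open>b\<close> when \<open>\<eta>\<close> solves that constraint. A tuple over \<open>D\<close>
  can only match constraints with \<open>set L \<subseteq> D\<close>, so \<open>sat\<close>
  suffices.\<close>

lemma flip_in_rel_iff:
  assumes cs: "\<And>L b. (L, b) \<in> set cs \<Longrightarrow> set L \<subseteq> {..<n div 2}"
    and sat: "\<And>L b. (L, b) \<in> set cs \<Longrightarrow> set L \<subseteq> D \<Longrightarrow> (\<Sum>y\<leftarrow>L. \<eta> y) = b"
    and es: "(\<lambda>e. e div 2) ` set es \<subseteq> D" and s: "s < length (xor_sig cs)"
  shows "map (flip n \<eta>) es \<in> rel (xor_struct n cs True) s \<longleftrightarrow> es \<in> rel (xor_struct n cs False) s"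
proof -
  define L where "L = fst (cs ! s)"
  define b where "b = snd (cs ! s)"
  have mem: "(L, b) \<in> set cs" using s by (simp add: L_def b_def xor_sig_def)
  have sum: "(\<Sum>e\<leftarrow>map (flip n \<eta>) es. of_nat e) = (\<Sum>e\<leftarrow>es. of_nat e) + b"
    if "map (\<lambda>e. e div 2) es = L"
  proof -
    have "set (map (\<lambda>e. e div 2) es) \<subseteq> {..<n div 2}" using cs[OF mem] that by simp
    then have "(\<Sum>e\<leftarrow>map (flip n \<eta>) es. of_nat e) = (\<Sum>e\<leftarrow>es. of_nat e + \<eta> (e div 2))"
      by (auto simp: of_nat_flip image_subset_iff intro!: arg_cong[where f = sum_list])
    also have "\<dots> = (\<Sum>e\<leftarrow>es. of_nat e) + (\<Sum>y\<leftarrow>map (\<lambda>e. e div 2) es. \<eta> y)"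
      by (simp add: sum_list_addf o_def)
    also have "(\<Sum>y\<leftarrow>map (\<lambda>e. e div 2) es. \<eta> y) = b"
      unfolding that using sat[OF mem] es that by force
    finally show ?thesis .
  qed
  have "map (\<lambda>e. e div 2) (map (flip n \<eta>) es) = map (\<lambda>e. e div 2) es" by simp
  moreover have "set (map (flip n \<eta>) es) \<subseteq> {..<n} \<longleftrightarrow> set es \<subseteq> {..<n}" by auto
  moreover have "x + b = b \<longleftrightarrow> x = 0" for x by simp
  ultimately show ?thesis
    using sum unfolding xor_struct_def L_def[symmetric] b_def[symmetric]
    by (simp del: map_map set_map add: L_def[symmetric] b_def[symmetric] cong: conj_cong)
qed

lemma atp_flip:
  assumes cs: "\<And>L b. (L, b) \<in> set cs \<Longrightarrow> set L \<subseteq> {..<n div 2}"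
    and sat: "\<And>L b. (L, b) \<in> set cs \<Longrightarrow> set L \<subseteq> D \<Longrightarrow> (\<Sum>y\<leftarrow>L. \<eta> y) = b"
    and v: "(\<lambda>e. e div 2) ` set v \<subseteq> D"
  shows "atp (xor_sig cs) (xor_struct n cs False) v =
         atp (xor_sig cs) (xor_struct n cs True) (map (flip n \<eta>) v)"
proof -
  have "map ((!) (map (flip n \<eta>) v)) js \<in> rel (xor_struct n cs True) s \<longleftrightarrow>
        map ((!) v) js \<in> rel (xor_struct n cs False) s"
    if "s < length (xor_sig cs)" "js \<in> tuples {..<length v} (xor_sig cs ! s)" for s js
  proof -
    have *: "map ((!) (map (flip n \<eta>) v)) js = map (flip n \<eta>) (map ((!) v) js)"
      using that(2) by (auto simp: tuples_def)
    have "set (map ((!) v) js) \<subseteq> set v" using that(2) by (auto simp: tuples_def)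
    then have "(\<lambda>e. e div 2) ` set (map ((!) v) js) \<subseteq> D" using v by blast
    then show ?thesis unfolding *
      using that(1) by (intro flip_in_rel_iff[OF cs sat])
  qed
  then show ?thesis
    unfolding atp_def by (auto simp del: map_map cong: conj_cong)
qed

lemma finite_tuples: "finite V \<Longrightarrow> finite (tuples V l)"
  using finite_lists_length_eq[of V l] by (simp add: tuples_def conj_commute)

text \<open>\<open>Good r D \<eta>\<close> says that Duplicator survives \<open>r\<close> more rounds when the variables in \<open>D\<close> are pebbled
  and those with \<open>\<eta> = 1\<close> are answered by the opposite value. One variable more than \<open>d\<close> must be
  allowed, because a refinement round places the new entry before it overwrites an old one.\<close>

locale duplicator =
  fixes n d R :: nat and cs :: "(nat list \<times> bit) list"
    and Good :: "nat \<Rightarrow> nat set \<Rightarrow> (nat \<Rightarrow> bit) \<Rightarrow> bool"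
  assumes cs_vars: "\<And>L b. (L, b) \<in> set cs \<Longrightarrow> set L \<subseteq> {..<n div 2}"
    and Good_sat: "\<And>r D \<eta> L b. Good r D \<eta> \<Longrightarrow> (L, b) \<in> set cs \<Longrightarrow> set L \<subseteq> D \<Longrightarrow> (\<Sum>y\<leftarrow>L. \<eta> y) = b"
    and Good_subset: "\<And>r D D' \<eta>. Good r D \<eta> \<Longrightarrow> D' \<subseteq> D \<Longrightarrow> Good r D' \<eta>"
    and Good_mono: "\<And>r D \<eta>. Good (Suc r) D \<eta> \<Longrightarrow> Good r D \<eta>"
    and Good_extend: "\<And>r D \<eta> y. Good (Suc r) D \<eta> \<Longrightarrow> finite D \<Longrightarrow> card D \<le> d \<Longrightarrow>
          \<exists>\<eta>'. (\<forall>z\<in>D. \<eta>' z = \<eta> z) \<and> Good r (insert y D) \<eta>'"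
    and Good_init: "\<exists>\<eta>. Good R {} \<eta>"
begin

abbreviation "A \<equiv> xor_struct n cs False"
abbreviation "B \<equiv> xor_struct n cs True"
abbreviation "\<sigma> \<equiv> xor_sig cs"

definition vars :: "nat list \<Rightarrow> nat set" where "vars v = (\<lambda>e. e div 2) ` set v"

lemma card_vars: "finite (vars v)" "card (vars v) \<le> length v"
  using card_image_le[of "set v" "\<lambda>e. e div 2"] card_length[of v] by (auto simp: vars_def)

lemma Good_response:
  assumes "Good (Suc r) (vars v) \<eta>" "length v \<le> d"
  obtains H where "\<And>y. Good r (insert y (vars v)) (H y)"
    and "\<And>y. map (flip n (H y)) v = map (flip n \<eta>) v"
    and "bij_betw (\<lambda>x. flip n (H (x div 2)) x) {..<n} {..<n}"
proof -
  have "\<forall>y. \<exists>\<eta>'. (\<forall>z\<in>vars v. \<eta>' z = \<eta> z) \<and> Good r (insert y (vars v)) \<eta>'"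
    using Good_extend[OF assms(1)] card_vars(1)[of v] le_trans[OF card_vars(2)[of v] assms(2)] by blast
  then obtain H where H: "\<And>y z. z \<in> vars v \<Longrightarrow> H y z = \<eta> z" "\<And>y. Good r (insert y (vars v)) (H y)"
    by metis
  have "map (flip n (H y)) v = map (flip n \<eta>) v" for y
    using H(1) by (auto simp: vars_def intro!: flip_cong)
  \<comment> \<open>\<open>flip\<close> never changes \<open>x div 2\<close>, so the answer used at
    \<open>x\<close> is used again at its image and the map is its own inverse.\<close>
  moreover have "bij_betw (\<lambda>x. flip n (H (x div 2)) x) {..<n} {..<n}"
    by (rule bij_betw_byWitness[where f' = "\<lambda>x. flip n (H (x div 2)) x"]) auto
  ultimately show thesis using H(2) that by blast
qed

lemma wl_flip_eq:
  assumes "Good r (vars v) \<eta>" "length v = d"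
  shows "wl \<sigma> d A r v = wl \<sigma> d B r (map (flip n \<eta>) v)"
  using assms
proof (induction r arbitrary: v \<eta>)
  case 0
  then show ?case
    using atp_flip[OF cs_vars Good_sat[OF 0(1)], where v = v] by (simp add: vars_def)
next
  case (Suc r)
  obtain H where H: "\<And>y. Good r (insert y (vars v)) (H y)"
      "\<And>y. map (flip n (H y)) v = map (flip n \<eta>) v"
      "bij_betw (\<lambda>x. flip n (H (x div 2)) x) {..<n} {..<n}" (is "bij_betw ?f _ _")
    using Good_response[OF Suc.prems(1)] Suc.prems(2) by auto
  let ?w = "map (flip n \<eta>) v"
  have upd: "wl \<sigma> d A r (v[i := x]) = wl \<sigma> d B r (?w[i := ?f x])" for i x
  proof -
    have "vars (v[i := x]) \<subseteq> insert (x div 2) (vars v)"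
      using set_update_subset_insert[of v i x] by (auto simp: vars_def)
    then have "Good r (vars (v[i := x])) (H (x div 2))" by (rule Good_subset[OF H(1)])
    from Suc.IH[OF this] have "wl \<sigma> d A r (v[i := x]) = wl \<sigma> d B r (map (flip n (H (x div 2))) (v[i := x]))"
      using Suc.prems(2) by simp
    then show ?thesis by (simp add: map_update H(2))
  qed
  have "image_mset (\<lambda>x. map (\<lambda>i. wl \<sigma> d B r (?w[i := x])) [0..<d]) (mset_set (?f ` {..<n})) =
        image_mset (\<lambda>x. map (\<lambda>i. wl \<sigma> d A r (v[i := x])) [0..<d]) (mset_set {..<n})"
    using H(3) unfolding upd bij_betw_def
    by (subst image_mset_mset_set[symmetric]) (simp_all add: multiset.map_comp o_def)
  moreover have "?f ` {..<n} = {..<n}" using H(3) by (simp add: bij_betw_def)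
  moreover have "wl \<sigma> d A r v = wl \<sigma> d B r ?w"
    using Suc.IH[OF Good_mono[OF Suc.prems(1)] Suc.prems(2)] .
  ultimately show ?case by (simp add: wl_refine_def)
qed

text \<open>Equal colors of single tuples are not enough, since distinguishing counts the tuples of
  each color. The bijection is built one coordinate at a time, at the price of one round per free
  coordinate, hence \<open>r + l\<close>.\<close>

lemma wl_bij:
  assumes "Good (r + l) (vars v) \<eta>" "length v + l = d"
  shows "\<exists>\<Phi>. bij_betw \<Phi> (tuples {..<n} l) (tuples {..<n} l) \<and>
     (\<forall>u\<in>tuples {..<n} l. wl \<sigma> d A r (v @ u) = wl \<sigma> d B r (map (flip n \<eta>) v @ \<Phi> u))"
  using assms
proof (induction l arbitrary: v \<eta>)
  case 0
  then show ?case using wl_flip_eq[of r v \<eta>] by (intro exI[of _ id]) (auto simp: tuples_def bij_betw_def)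
next
  case (Suc l)
  obtain H where H: "\<And>y. Good (r + l) (insert y (vars v)) (H y)"
      "\<And>y. map (flip n (H y)) v = map (flip n \<eta>) v"
    by (rule Good_response[of "r + l" v \<eta>]) (use Suc.prems in auto)
  let ?f = "\<lambda>x. flip n (H (x div 2)) x"
  have "\<exists>\<Phi>. bij_betw \<Phi> (tuples {..<n} l) (tuples {..<n} l) \<and>
     (\<forall>u\<in>tuples {..<n} l. wl \<sigma> d A r ((v @ [x]) @ u) =
        wl \<sigma> d B r (map (flip n (H (x div 2))) (v @ [x]) @ \<Phi> u))" for x
    using H(1)[of "x div 2"] Suc.prems(2) by (intro Suc.IH) (auto simp: vars_def)
  then obtain \<Phi> where \<Phi>: "\<And>x. bij_betw (\<Phi> x) (tuples {..<n} l) (tuples {..<n} l)"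
    "\<And>x u. u \<in> tuples {..<n} l \<Longrightarrow> wl \<sigma> d A r ((v @ [x]) @ u) =
        wl \<sigma> d B r (map (flip n (H (x div 2))) (v @ [x]) @ \<Phi> x u)"
    by metis
  define \<Psi> where "\<Psi> u = ?f (hd u) # \<Phi> (hd u) (tl u)" for u
  have split: "\<exists>x u'. u = x # u' \<and> x < n \<and> u' \<in> tuples {..<n} l" if "u \<in> tuples {..<n} (Suc l)" for u
    using that by (cases u) (auto simp: tuples_def)
  have "inj_on \<Psi> (tuples {..<n} (Suc l))"
  proof (rule inj_onI)
    fix u u' assume "u \<in> tuples {..<n} (Suc l)" "u' \<in> tuples {..<n} (Suc l)" and eq: "\<Psi> u = \<Psi> u'"
    then obtain x t x' t' where u: "u = x # t" "t \<in> tuples {..<n} l" "u' = x' # t'" "t' \<in> tuples {..<n} l"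
      using split by metis
    \<comment> \<open>The first entry of the image determines \<open>x div 2\<close>, thereby the
      answer \<open>H (x div 2)\<close>, and thereby \<open>x\<close>; only then can the tails be
      compared under the same \<open>\<Phi> x\<close>.\<close>
    have 1: "?f x = ?f x'" and 2: "\<Phi> x t = \<Phi> x' t'" using eq u by (simp_all add: \<Psi>_def)
    from 1 have "x div 2 = x' div 2" by (metis flip_div2)
    with 1 have "x = x'" by simp
    with 2 \<Phi>(1)[of x] u show "u = u'" by (auto simp: bij_betw_def dest: inj_onD)
  qed
  moreover have "\<Psi> ` tuples {..<n} (Suc l) \<subseteq> tuples {..<n} (Suc l)"
  proof
    fix z assume "z \<in> \<Psi> ` tuples {..<n} (Suc l)"
    then obtain x t where "x < n" "t \<in> tuples {..<n} l" "z = ?f x # \<Phi> x t"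
      using split by (fastforce simp: \<Psi>_def)
    moreover from this have "\<Phi> x t \<in> tuples {..<n} l" using \<Phi>(1)[of x] by (auto simp: bij_betw_def)
    ultimately show "z \<in> tuples {..<n} (Suc l)" by (auto simp: tuples_def)
  qed
  ultimately have "bij_betw \<Psi> (tuples {..<n} (Suc l)) (tuples {..<n} (Suc l))"
    by (simp add: bij_betw_def endo_inj_surj finite_tuples)
  moreover have "wl \<sigma> d A r (v @ u) = wl \<sigma> d B r (map (flip n \<eta>) v @ \<Psi> u)"
    if u: "u \<in> tuples {..<n} (Suc l)" for u
  proof -
    obtain x t where "u = x # t" "t \<in> tuples {..<n} l" using split[OF u] by auto
    then show ?thesis using \<Phi>(2)[of t x] by (simp add: \<Psi>_def H(2))
  qed
  ultimately show ?case by blast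
qed

lemma not_distinguished:
  assumes "r + d \<le> R"
  shows "\<not> wl_distinguishes_after \<sigma> d r A B"
proof -
  have mono: "Good s D \<eta> \<Longrightarrow> s' \<le> s \<Longrightarrow> Good s' D \<eta>" for s s' D \<eta>
    by (induction s) (auto simp: le_Suc_eq dest: Good_mono)
  obtain \<eta> where "Good R {} \<eta>" using Good_init by blast
  then have "Good (r + d) (vars []) \<eta>" using mono assms by (auto simp: vars_def)
  from wl_bij[OF this] obtain \<Phi> where \<Phi>: "bij_betw \<Phi> (tuples {..<n} d) (tuples {..<n} d)"
    "\<And>u. u \<in> tuples {..<n} d \<Longrightarrow> wl \<sigma> d A r u = wl \<sigma> d B r (\<Phi> u)"
    by auto
  have "card {v \<in> tuples {..<n} d. wl \<sigma> d A r v = c} = card {v \<in> tuples {..<n} d. wl \<sigma> d B r v = c}" for c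
  proof (rule bij_betw_same_card[of \<Phi>])
    show "bij_betw \<Phi> {v \<in> tuples {..<n} d. wl \<sigma> d A r v = c} {v \<in> tuples {..<n} d. wl \<sigma> d B r v = c}"
    proof (rule bij_betw_subset[OF \<Phi>(1)])
      show "\<Phi> ` {v \<in> tuples {..<n} d. wl \<sigma> d A r v = c} = {v \<in> tuples {..<n} d. wl \<sigma> d B r v = c}"
      proof
        show "\<Phi> ` {v \<in> tuples {..<n} d. wl \<sigma> d A r v = c} \<subseteq> {v \<in> tuples {..<n} d. wl \<sigma> d B r v = c}"
          using \<Phi> by (auto simp: bij_betw_def)
        show "{v \<in> tuples {..<n} d. wl \<sigma> d B r v = c} \<subseteq> \<Phi> ` {v \<in> tuples {..<n} d. wl \<sigma> d A r v = c}"
        proof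
          fix w assume w: "w \<in> {v \<in> tuples {..<n} d. wl \<sigma> d B r v = c}"
          then obtain u where "u \<in> tuples {..<n} d" "w = \<Phi> u"
            using \<Phi>(1) by (auto simp: bij_betw_def)
          then show "w \<in> \<Phi> ` {v \<in> tuples {..<n} d. wl \<sigma> d A r v = c}"
            using w \<Phi>(2) by auto
        qed
      qed
    qed auto
  qed
  then show ?thesis by (simp add: wl_distinguishes_after_def)
qed

end

section \<open>Spoiler's moves read off from equal colors\<close>

lemma wl_eq_imp_atp_eq: "wl \<sigma> m A r v = wl \<sigma> m B r w \<Longrightarrow> atp \<sigma> A v = atp \<sigma> B w"
  by (induction r) (auto simp: wl_refine_def)

lemma wl_Suc_eqD:
  assumes eq: "wl \<sigma> m A (Suc r) v = wl \<sigma> m B (Suc r) w"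
    and fin: "finite (univ A)" "finite (univ B)" and x: "x \<in> univ A"
  shows "\<exists>x'\<in>univ B. \<forall>i<m. wl \<sigma> m A r (v[i := x]) = wl \<sigma> m B r (w[i := x'])"
proof -
  let ?F = "\<lambda>C v x. map (\<lambda>i. wl \<sigma> m C r (v[i := x])) [0..<m]"
  have "image_mset (?F A v) (mset_set (univ A)) = image_mset (?F B w) (mset_set (univ B))"
    using eq by (simp add: wl_refine_def)
  from arg_cong[OF this, of set_mset] have "?F A v ` univ A = ?F B w ` univ B"
    using fin by simp
  then obtain x' where "x' \<in> univ B" "?F A v x = ?F B w x'" using x by blast
  then show ?thesis by auto
qed

text \<open>One refinement round lets Spoiler overwrite one position, so a window of consecutive
  positions costs its length in rounds. The replies inside the window are arbitrary; the rest of
  \<open>w\<close> is kept.\<close>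

lemma wl_eq_place:
  assumes "wl \<sigma> k A (r + length ts) v = wl \<sigma> k B (r + length ts) w"
    and "a + length ts \<le> k" "length v = k" "length w = k"
    and "finite (univ A)" "finite (univ B)" "set ts \<subseteq> univ A"
  shows "\<exists>w'. length w' = k \<and>
     wl \<sigma> k A r (take a v @ ts @ drop (a + length ts) v) = wl \<sigma> k B r w' \<and>
     (\<forall>i. i < a \<or> a + length ts \<le> i \<longrightarrow> w' ! i = w ! i)"
  using assms
proof (induction ts arbitrary: a v w)
  case Nil
  then show ?case by (intro exI[of _ w]) auto
next
  case (Cons t ts)
  obtain x where x: "\<And>i. i < k \<Longrightarrow> wl \<sigma> k A (r + length ts) (v[i := t]) = wl \<sigma> k B (r + length ts) (w[i := x])"
    using wl_Suc_eqD[of \<sigma> k A "r + length ts" v B w t] Cons.prems by auto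
  have ex: "\<exists>w'. length w' = k \<and>
     wl \<sigma> k A r (take (Suc a) (v[a := t]) @ ts @ drop (Suc a + length ts) (v[a := t])) = wl \<sigma> k B r w' \<and>
     (\<forall>i. i < Suc a \<or> Suc a + length ts \<le> i \<longrightarrow> w' ! i = w[a := x] ! i)"
    using Cons.prems by (intro Cons.IH x) auto
  have list: "take (Suc a) (v[a := t]) @ ts @ drop (Suc a + length ts) (v[a := t]) =
      take a v @ (t # ts) @ drop (a + length (t # ts)) v"
    using Cons.prems by (simp add: take_Suc_conv_app_nth)
  obtain w' where w': "length w' = k"
     "wl \<sigma> k A r (take a v @ (t # ts) @ drop (a + length (t # ts)) v) = wl \<sigma> k B r w'"
     "\<And>i. i < Suc a \<or> Suc a + length ts \<le> i \<Longrightarrow> w' ! i = w[a := x] ! i"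
    using ex unfolding list by blast
  have "w' ! i = w ! i" if "i < a \<or> a + length (t # ts) \<le> i" for i
    using w'(3)[of i] that by auto
  with w' show ?case by blast
qed

text \<open>Spoiler only places \<open>2 * y\<close>, the element for value \<open>0\<close> of
  variable \<open>y\<close>. Such a tuple lies in the untwisted relation, so equal atomic types
  force the replies into the twisted one and fix their parity.\<close>

lemma atp_eq_constraint:
  assumes atp: "atp (xor_sig cs) (xor_struct n cs False) v = atp (xor_sig cs) (xor_struct n cs True) w"
    and c: "(L, b) \<in> set cs" "set L \<subseteq> {..<n div 2}"
    and js: "map ((!) v) js = map ((*) 2) L" "set js \<subseteq> {..<length v}"
  shows "(\<Sum>j\<leftarrow>js. of_nat (w ! j)) = b"
proof -
  obtain s where s: "s < length cs" "cs ! s = (L, b)" using c by (auto simp: in_set_conv_nth)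
  let ?T = "\<lambda>C v. {js \<in> tuples {..<length v} (xor_sig cs ! s). map ((!) v) js \<in> rel C s}"
  have "?T (xor_struct n cs False) v = ?T (xor_struct n cs True) w"
    using atp s(1) by (simp add: atp_def xor_sig_def)
  moreover have "js \<in> ?T (xor_struct n cs False) v"
  proof -
    have "length js = length L" using arg_cong[OF js(1), of length] by simp
    moreover have "map (\<lambda>e. e div 2) (map ((!) v) js) = L" unfolding js(1) by (simp add: o_def)
    moreover have "(\<Sum>e\<leftarrow>map ((*) 2) L. of_nat e) = (0::bit)"
      by (induction L) auto
    moreover have "set (map ((*) 2) L) \<subseteq> {..<n}" using c(2) by auto
    ultimately show ?thesis
      using js s by (simp add: tuples_def xor_sig_def xor_struct_def del: set_map map_map)
  qed
  ultimately have "map ((!) w) js \<in> rel (xor_struct n cs True) s" by blast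
  then show ?thesis using s by (simp add: xor_struct_def o_def)
qed

text \<open>Spoiler keeps up to three circuit vertices on the board, each in its own slot of \<open>\<Delta>\<close> positions.
  A vertex with wrong parity has an input with wrong parity, so the error moves down to a source.\<close>

locale spoiler =
  fixes n k \<Delta> S :: nat and cs :: "(nat list \<times> bit) list"
    and W :: "nat \<Rightarrow> 'v set" and nb :: "'v \<Rightarrow> nat list" and sink :: 'v
  assumes cs_vars: "\<And>L b. (L, b) \<in> set cs \<Longrightarrow> set L \<subseteq> {..<n div 2}"
    and source: "\<And>x. x \<in> W 0 \<Longrightarrow> (nb x, 0) \<in> set cs"
    and gate: "\<And>x s. x \<in> W (Suc s) \<Longrightarrow> \<exists>x1\<in>W s. (nb x @ nb x1, 0) \<in> set cs \<or>
        (\<exists>x2\<in>W s. (nb x @ nb x1 @ nb x2, 0) \<in> set cs)"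
    and sink: "sink \<in> W S" "(nb sink, 1) \<in> set cs"
    and length_nb: "\<And>x s. x \<in> W s \<Longrightarrow> length (nb x) = \<Delta>"
    and nb_vars: "\<And>x s. x \<in> W s \<Longrightarrow> set (nb x) \<subseteq> {..<n div 2}"
    and k: "3 * \<Delta> \<le> k" and n: "0 < n"
begin

abbreviation "A \<equiv> xor_struct n cs False"
abbreviation "B \<equiv> xor_struct n cs True"
abbreviation "\<sigma> \<equiv> xor_sig cs"

definition slot :: "nat \<Rightarrow> nat list" where "slot q = [q * \<Delta>..<q * \<Delta> + \<Delta>]"

definition holds :: "nat list \<Rightarrow> nat \<Rightarrow> 'v \<Rightarrow> bool" where
  "holds v q x \<longleftrightarrow> map ((!) v) (slot q) = map ((*) 2) (nb x)"

definition wrong :: "nat list \<Rightarrow> nat \<Rightarrow> bit" where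
  "wrong w q = (\<Sum>j\<leftarrow>slot q. of_nat (w ! j))"

lemma slot_bound: "q < 3 \<Longrightarrow> j \<in> set (slot q) \<Longrightarrow> j < k"
proof -
  assume "q < 3" "j \<in> set (slot q)"
  then have "j < (q + 1) * \<Delta>" "(q + 1) * \<Delta> \<le> 3 * \<Delta>"
    unfolding slot_def by (auto intro!: mult_right_mono simp del: mult_le_cancel2)
  then show "j < k" using k by linarith
qed

lemma place_slot:
  assumes eq: "wl \<sigma> k A (r + \<Delta>) v = wl \<sigma> k B (r + \<Delta>) w" and len: "length v = k" "length w = k"
    and q: "q < 3" and x: "x \<in> W s"
  obtains v' w' where "length v' = k" "length w' = k" "wl \<sigma> k A r v' = wl \<sigma> k B r w'"
    "holds v' q x" "\<And>q' x'. q' < 3 \<Longrightarrow> q' \<noteq> q \<Longrightarrow> holds v q' x' \<Longrightarrow> holds v' q' x'"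
    "\<And>q'. q' < 3 \<Longrightarrow> q' \<noteq> q \<Longrightarrow> wrong w' q' = wrong w q'"
proof -
  let ?ts = "map ((*) 2) (nb x)"
  let ?a = "q * \<Delta>"
  have lt: "length ?ts = \<Delta>" using length_nb[OF x] by simp
  have "(q + 1) * \<Delta> \<le> 3 * \<Delta>" using q by (intro mult_right_mono) auto
  then have aD: "?a + \<Delta> \<le> k" using k unfolding add_mult_distrib by linarith
  have sub: "set ?ts \<subseteq> univ A" using nb_vars[OF x] by auto
  define v' where "v' = take ?a v @ ?ts @ drop (?a + \<Delta>) v"
  from wl_eq_place[of \<sigma> k A r ?ts v B w ?a] eq len sub aD
  obtain w' where w': "length w' = k" "wl \<sigma> k A r v' = wl \<sigma> k B r w'"
    "\<And>i. i < ?a \<or> ?a + \<Delta> \<le> i \<Longrightarrow> w' ! i = w ! i"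
    unfolding lt v'_def by fastforce
  have outside: "j < ?a \<or> ?a + \<Delta> \<le> j" if "q' \<noteq> q" "j \<in> set (slot q')" for q' j
  proof (cases "q' < q")
    case True
    then have "Suc q' * \<Delta> \<le> q * \<Delta>" by (intro mult_right_mono) auto
    then show ?thesis using that by (auto simp: slot_def)
  next
    case False
    then have "Suc q * \<Delta> \<le> q' * \<Delta>" using that by (intro mult_right_mono) auto
    then show ?thesis using that by (auto simp: slot_def)
  qed
  have v'_out: "v' ! i = v ! i" if "i < ?a \<or> ?a + \<Delta> \<le> i" "i < k" for i
    using that len aD lt unfolding v'_def
    by (auto simp: nth_append min_def)
  have v'_in: "map ((!) v') (slot q) = ?ts"
    using lt len aD by (auto simp: slot_def v'_def nth_append intro!: nth_equalityI)
  show thesis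
  proof (rule that[of v' w'])
    show "length v' = k" using len aD lt by (simp add: v'_def)
    show "holds v' q' x'" if "q' < 3" "q' \<noteq> q" "holds v q' x'" for q' x'
    proof -
      have "map ((!) v') (slot q') = map ((!) v) (slot q')"
        using outside[OF that(2)] slot_bound[OF that(1)] by (auto intro!: v'_out)
      then show ?thesis using that(3) unfolding holds_def by metis
    qed
    show "wrong w' q' = wrong w q'" if "q' < 3" "q' \<noteq> q" for q'
      unfolding wrong_def using outside[OF that(2)] w'(3)
      by (intro arg_cong[where f = sum_list] map_cong) auto
  qed (use w' v'_in in \<open>auto simp: holds_def\<close>)
qed

lemma constraint_slots:
  assumes "wl \<sigma> k A r v = wl \<sigma> k B r w" "length v = k"
    and "\<And>q. q \<in> set qs \<Longrightarrow> q < 3" "list_all2 (holds v) qs xs" "(concat (map nb xs), b) \<in> set cs"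
  shows "(\<Sum>q\<leftarrow>qs. wrong w q) = b"
proof -
  have "map ((!) v) (concat (map slot qs)) = map ((*) 2) (concat (map nb xs))"
    using assms(4) by (induction rule: list_all2_induct) (auto simp: holds_def)
  moreover have "set (concat (map slot qs)) \<subseteq> {..<length v}"
    using assms(2,3) slot_bound by auto
  ultimately have "(\<Sum>j\<leftarrow>concat (map slot qs). of_nat (w ! j)) = b"
    using cs_vars[OF assms(5)]
    by (intro atp_eq_constraint[OF wl_eq_imp_atp_eq[OF assms(1)] assms(5)])
  moreover have "(\<Sum>j\<leftarrow>concat (map slot qs). of_nat (w ! j)) = (\<Sum>q\<leftarrow>qs. wrong w q)"
    by (induction qs) (auto simp: wrong_def)
  ultimately show ?thesis by simp
qed

text \<open>The two inputs go to the free slots at \<open>\<Delta>\<close> rounds each, which is the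
  cost \<open>2 * \<Delta>\<close> per level. Only the slot with the error is kept for the next
  level, so three slots suffice at any depth.\<close>

lemma wrong_imp_wl_neq:
  assumes "x \<in> W s" "q < 3" "holds v q x" "wrong w q = 1" "length v = k" "length w = k"
  shows "wl \<sigma> k A (s * (2 * \<Delta>)) v \<noteq> wl \<sigma> k B (s * (2 * \<Delta>)) w"
  using assms
proof (induction s arbitrary: x q v w)
  case 0
  show ?case
  proof
    assume "wl \<sigma> k A (0 * (2 * \<Delta>)) v = wl \<sigma> k B (0 * (2 * \<Delta>)) w"
    from constraint_slots[OF this 0(5), of "[q]" "[x]" 0] 0 source[OF 0(1)] show False by simp
  qed
next
  case (Suc s)
  show ?case
  proof
    assume "wl \<sigma> k A (Suc s * (2 * \<Delta>)) v = wl \<sigma> k B (Suc s * (2 * \<Delta>)) w"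
    then have eq: "wl \<sigma> k A ((s * (2 * \<Delta>) + \<Delta>) + \<Delta>) v = wl \<sigma> k B ((s * (2 * \<Delta>) + \<Delta>) + \<Delta>) w"
      by (simp add: algebra_simps)
    \<comment> \<open>If the gate has a single input, \<open>x2\<close> is an arbitrary vertex of
      the layer, placed only to keep the number of rounds uniform.\<close>
    obtain x1 x2 where xs: "x1 \<in> W s" "x2 \<in> W s"
      and c: "(nb x @ nb x1, 0) \<in> set cs \<or> (nb x @ nb x1 @ nb x2, 0) \<in> set cs"
      using gate[OF Suc.prems(1)] by blast
    obtain q1 q2 where q: "q1 < 3" "q2 < 3" "q1 \<noteq> q" "q2 \<noteq> q" "q1 \<noteq> q2"
    proof -
      have "q = 0 \<or> q = 1 \<or> q = 2" using Suc.prems(2) by auto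
      then show thesis by (elim disjE) (use that[of 1 2] that[of 0 2] that[of 0 1] in simp_all)
    qed
    obtain v1 w1 where 1: "length v1 = k" "length w1 = k"
      "wl \<sigma> k A (s * (2 * \<Delta>) + \<Delta>) v1 = wl \<sigma> k B (s * (2 * \<Delta>) + \<Delta>) w1"
      "holds v1 q1 x1" "holds v1 q x" "wrong w1 q = 1"
      by (rule place_slot[OF eq Suc.prems(5,6) q(1) xs(1)]) (use Suc.prems q in simp)
    obtain v2 w2 where 2: "length v2 = k" "length w2 = k"
      "wl \<sigma> k A (s * (2 * \<Delta>)) v2 = wl \<sigma> k B (s * (2 * \<Delta>)) w2"
      "holds v2 q1 x1" "holds v2 q2 x2" "holds v2 q x" "wrong w2 q = 1"
      by (rule place_slot[OF 1(3,1,2) q(2) xs(2)]) (use 1 q Suc.prems(2) in simp)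
    have "wrong w2 q1 = 1 \<or> wrong w2 q2 = 1"
      using c
    proof
      assume "(nb x @ nb x1, 0) \<in> set cs"
      then have "(\<Sum>p\<leftarrow>[q, q1]. wrong w2 p) = 0"
        using 2 q Suc.prems(2) by (intro constraint_slots[OF 2(3,1), where xs = "[x, x1]"]) auto
      then show ?thesis using 2 by simp
    next
      assume "(nb x @ nb x1 @ nb x2, 0) \<in> set cs"
      then have "(\<Sum>p\<leftarrow>[q, q1, q2]. wrong w2 p) = 0"
        using 2 q Suc.prems(2) by (intro constraint_slots[OF 2(3,1), where xs = "[x, x1, x2]"]) auto
      then show ?thesis using 2 by (cases "wrong w2 q1"; cases "wrong w2 q2") auto
    qed
    then show False
      using Suc.IH[OF xs(1) q(1) 2(4) _ 2(1,2)] Suc.IH[OF xs(2) q(2) 2(5) _ 2(1,2)] 2(3) by blast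
  qed
qed

lemma distinguished: "wl_distinguishes \<sigma> k A B"
proof (rule ccontr)
  assume "\<not> ?thesis"
  then have card_eq: "card {v \<in> tuples {..<n} k. wl \<sigma> k A r v = c} =
      card {v \<in> tuples {..<n} k. wl \<sigma> k B r v = c}" for r c
    by (auto simp: wl_distinguishes_def wl_distinguishes_after_def)
  \<comment> \<open>Any tuple can start the game: its color class is nonempty in \<open>A\<close>,
    and equal counts supply a partner in \<open>B\<close>. The extra \<open>\<Delta>\<close> rounds
    place the sink, whose constraint makes its slot wrong at once.\<close>
  let ?r = "S * (2 * \<Delta>) + \<Delta>" and ?v = "replicate k 0"
  have fin: "finite (tuples {..<n} k)" by (simp add: finite_tuples)
  have "?v \<in> {v \<in> tuples {..<n} k. wl \<sigma> k A ?r v = wl \<sigma> k A ?r ?v}"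
    using n by (auto simp: tuples_def)
  then have "card {v \<in> tuples {..<n} k. wl \<sigma> k A ?r v = wl \<sigma> k A ?r ?v} \<noteq> 0"
    using fin by (subst card_0_eq) auto
  then have "{v \<in> tuples {..<n} k. wl \<sigma> k B ?r v = wl \<sigma> k A ?r ?v} \<noteq> {}"
    unfolding card_eq by (metis card.empty)
  then obtain w where w: "length w = k" "wl \<sigma> k A ?r ?v = wl \<sigma> k B ?r w"
    by (auto simp: tuples_def)
  obtain v' w' where 1: "length v' = k" "length w' = k"
     "wl \<sigma> k A (S * (2 * \<Delta>)) v' = wl \<sigma> k B (S * (2 * \<Delta>)) w'" "holds v' 0 sink"
    by (rule place_slot[OF w(2) length_replicate w(1) _ sink(1), of 0]) auto
  have "(\<Sum>p\<leftarrow>[0]. wrong w' p) = 1"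
    using 1 sink by (intro constraint_slots[OF 1(3,1), where xs = "[sink]"]) auto
  then show False using wrong_imp_wl_neq[OF sink(1), of 0 v' w'] 1 by simp
qed

end

section \<open>Expanders\<close>

text \<open>Such a function is recovered from a list of \<open>t\<close> values, an index into this
  list for each element of \<open>E\<close>, and its restriction to the rest; the three factors
  count these data.\<close>

lemma card_small_image_functions:
  fixes h t :: nat
  assumes fin: "finite U" and EU: "E \<subseteq> U" and h: "0 < h"
  shows "card {f \<in> U \<rightarrow>\<^sub>E {..<h}. card (f ` E) \<le> t} \<le> h ^ t * t ^ card E * h ^ (card U - card E)"
proof -
  have finE: "finite E" using fin EU finite_subset by blast
  let ?P = "({..<t} \<rightarrow>\<^sub>E {..<h}) \<times> (E \<rightarrow>\<^sub>E {..<t}) \<times> ((U - E) \<rightarrow>\<^sub>E {..<h})"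
  define \<Theta> where "\<Theta> = (\<lambda>(\<phi>::nat \<Rightarrow> nat, \<psi>, \<rho>). \<lambda>e\<in>U. if e \<in> E then \<phi> (\<psi> e) else (\<rho> e :: nat))"
  have "{f \<in> U \<rightarrow>\<^sub>E {..<h}. card (f ` E) \<le> t} \<subseteq> \<Theta> ` ?P"
  proof
    fix f assume "f \<in> {f \<in> U \<rightarrow>\<^sub>E {..<h}. card (f ` E) \<le> t}"
    then have f: "f \<in> U \<rightarrow>\<^sub>E {..<h}" "card (f ` E) \<le> t" by auto
    obtain g where g: "bij_betw g {0..<card (f ` E)} (f ` E)"
      using ex_bij_betw_nat_finite[of "f ` E"] finE by blast
    define g' where "g' = inv_into {0..<card (f ` E)} g"
    have g': "g (g' y) = y" "g' y < card (f ` E)" if "y \<in> f ` E" for y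
      using g that inv_into_into[of y g "{0..<card (f ` E)}"] f_inv_into_f[of y g "{0..<card (f ` E)}"]
      unfolding g'_def bij_betw_def by auto
    define \<phi> where "\<phi> = (\<lambda>i\<in>{..<t}. if i < card (f ` E) then g i else 0)"
    define \<psi> where "\<psi> = (\<lambda>e\<in>E. g' (f e))"
    define \<rho> where "\<rho> = restrict f (U - E)"
    have "g i < h" if "i < card (f ` E)" for i
    proof -
      have "g i \<in> f ` E" using g that by (auto simp: bij_betw_def)
      then show ?thesis using f EU by auto
    qed
    moreover have "g' (f e) < t" if "e \<in> E" for e
      using g'(2)[of "f e"] f(2) that by simp
    ultimately have "(\<phi>, \<psi>, \<rho>) \<in> ?P"
      using f h by (auto simp: \<phi>_def \<psi>_def \<rho>_def)
    moreover have "\<Theta> (\<phi>, \<psi>, \<rho>) = f"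
    proof
      fix e
      show "\<Theta> (\<phi>, \<psi>, \<rho>) e = f e"
        using f g'[of "f e"]
        by (auto simp: \<Theta>_def \<phi>_def \<psi>_def \<rho>_def restrict_def PiE_def extensional_def dest: less_le_trans)
    qed
    ultimately show "f \<in> \<Theta> ` ?P" by force
  qed
  then have "card {f \<in> U \<rightarrow>\<^sub>E {..<h}. card (f ` E) \<le> t} \<le> card ?P"
    by (rule surj_card_le[rotated]) (use fin finE in \<open>auto intro!: finite_cartesian_product finite_PiE\<close>)
  also have "\<dots> = h ^ t * t ^ card E * h ^ (card U - card E)"
    using fin finE EU by (simp add: card_cartesian_product card_PiE card_Diff_subset)
  finally show ?thesis .
qed

lemma sum_power_card_Pow:
  fixes x :: real
  assumes "finite V"
  shows "(\<Sum>S\<in>Pow V. x ^ card S) = (1 + x) ^ card V"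
  using assms
proof (induction V rule: finite_induct)
  case (insert v V)
  have "inj_on (insert v) (Pow V)" using insert(2) by (auto simp: inj_on_def)
  moreover have "(\<Sum>S\<in>Pow V. x ^ card (insert v S)) = (\<Sum>S\<in>Pow V. x * x ^ card S)"
    using insert(1,2) by (intro sum.cong) (auto simp: card_insert_if finite_subset)
  moreover have "Pow V \<inter> insert v ` Pow V = {}" using insert(2) by auto
  ultimately show ?case
    using insert by (simp add: Pow_insert sum.union_disjoint sum.reindex sum_distrib_left[symmetric] algebra_simps)
qed simp

text \<open>Union bound for random \<open>nb\<close>. A set of \<open>s\<close> vertices fails with
  probability at most \<open>((6 * M) ^ (8 * D) / h ^ (2 * D)) ^ s\<close>, where
  \<open>2 * D\<close> is the gap between degree and expansion. By \<open>bound\<close> this is at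
  most \<open>(1 / (2 * N)) ^ s\<close> with \<open>N = card V\<close>, and the sum over nonempty
  sets is at most \<open>exp (1 / 2) - 1 < 1\<close>.\<close>

lemma expander_exists:
  fixes V :: "'v set" and D M h :: nat
  assumes fin: "finite V" "V \<noteq> {}" and h: "0 < h"
    and bound: "2 * card V * (6 * M) ^ (8 * D) \<le> h ^ (2 * D)"
  shows "\<exists>nb :: 'v \<Rightarrow> nat \<Rightarrow> nat. (\<forall>x\<in>V. \<forall>i<8 * D. nb x i < h) \<and>
    (\<forall>S\<subseteq>V. S \<noteq> {} \<longrightarrow> D * card S \<le> M \<longrightarrow>
       6 * D * card S < card ((\<lambda>(x, i). nb x i) ` (S \<times> {..<8 * D})))"
proof -
  let ?U = "V \<times> {..<8 * D}"
  let ?\<Omega> = "?U \<rightarrow>\<^sub>E {..<h}"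
  let ?N = "card V"
  have N: "0 < ?N" using fin by (simp add: card_gt_0_iff)
  define \<B> where "\<B> = {S. S \<subseteq> V \<and> S \<noteq> {} \<and> D * card S \<le> M}"
  define Bad where "Bad S = {f \<in> ?\<Omega>. card (f ` (S \<times> {..<8 * D})) \<le> 6 * D * card S}" for S
  have fin\<Omega>: "finite ?\<Omega>" using fin by (intro finite_PiE) auto
  have card\<Omega>: "card ?\<Omega> = h ^ (?N * (8 * D))"
    using fin by (simp add: card_PiE card_cartesian_product)
  have fin\<B>: "finite \<B>" unfolding \<B>_def by (rule finite_subset[of _ "Pow V"]) (use fin in auto)
  have bad: "card (Bad S) * (2 * ?N) ^ card S \<le> card ?\<Omega>" if "S \<in> \<B>" for S
  proof -
    let ?s = "card S"
    have S: "S \<subseteq> V" "D * ?s \<le> M" using that by (auto simp: \<B>_def)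
    have sN: "?s \<le> ?N" using S fin by (simp add: card_mono)
    have "card (Bad S) \<le> h ^ (6 * D * ?s) * (6 * D * ?s) ^ card (S \<times> {..<8 * D}) * h ^ (card ?U - card (S \<times> {..<8 * D}))"
      unfolding Bad_def using fin h S by (intro card_small_image_functions) auto
    also have "\<dots> = h ^ (6 * D * ?s) * (6 * D * ?s) ^ (?s * (8 * D)) * h ^ (?N * (8 * D) - ?s * (8 * D))"
      by (simp add: card_cartesian_product)
    also have "\<dots> \<le> h ^ (6 * D * ?s) * (6 * M) ^ (?s * (8 * D)) * h ^ (?N * (8 * D) - ?s * (8 * D))"
    proof -
      have "6 * D * ?s \<le> 6 * M" using S(2) by simp
      then show ?thesis by (intro mult_right_mono mult_left_mono power_mono) simp_all
    qed
    finally have "card (Bad S) * (2 * ?N) ^ ?s \<le>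
        h ^ (6 * D * ?s) * (6 * M) ^ (?s * (8 * D)) * h ^ (?N * (8 * D) - ?s * (8 * D)) * (2 * ?N) ^ ?s"
      by (rule mult_right_mono) simp
    also have "\<dots> = (2 * ?N * (6 * M) ^ (8 * D)) ^ ?s * (h ^ (6 * D * ?s) * h ^ (?N * (8 * D) - ?s * (8 * D)))"
      by (simp add: power_mult_distrib power_mult mult_ac) (simp add: power_mult[symmetric] mult_ac)
    also have "\<dots> \<le> (h ^ (2 * D)) ^ ?s * (h ^ (6 * D * ?s) * h ^ (?N * (8 * D) - ?s * (8 * D)))"
      using bound by (intro mult_right_mono power_mono) auto
    also have "\<dots> = h ^ (2 * D * ?s + (6 * D * ?s + (?N * (8 * D) - ?s * (8 * D))))"
      by (simp only: power_add power_mult)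
    also have "2 * D * ?s + (6 * D * ?s + (?N * (8 * D) - ?s * (8 * D))) = ?N * (8 * D)"
    proof -
      have "?s * (8 * D) \<le> ?N * (8 * D)" using sN by (rule mult_right_mono) simp
      moreover have "2 * D * ?s + 6 * D * ?s = ?s * (8 * D)" by simp
      ultimately show ?thesis by linarith
    qed
    finally show ?thesis by (simp only: card\<Omega>)
  qed
  have \<Omega>pos: "0 < real (card ?\<Omega>)" using h card\<Omega> by simp
  have "real (card (\<Union>S\<in>\<B>. Bad S)) \<le> (\<Sum>S\<in>\<B>. real (card (Bad S)))"
    using card_UN_le[OF fin\<B>, of Bad] by (simp flip: of_nat_sum)
  also have "\<dots> \<le> (\<Sum>S\<in>\<B>. real (card ?\<Omega>) * (1 / (2 * real ?N)) ^ card S)"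
  proof (rule sum_mono)
    fix S assume "S \<in> \<B>"
    from bad[OF this] have "real (card (Bad S)) * (2 * real ?N) ^ card S \<le> real (card ?\<Omega>)"
      by (simp flip: of_nat_le_iff[where 'a = real])
    then show "real (card (Bad S)) \<le> real (card ?\<Omega>) * (1 / (2 * real ?N)) ^ card S"
      using N by (simp add: power_one_over field_simps)
  qed
  also have "\<dots> \<le> (\<Sum>S\<in>Pow V - {{}}. real (card ?\<Omega>) * (1 / (2 * real ?N)) ^ card S)"
    using fin by (intro sum_mono2) (auto simp: \<B>_def)
  also have "\<dots> = real (card ?\<Omega>) * ((1 + 1 / (2 * real ?N)) ^ ?N - 1)"
    using fin sum_power_card_Pow[of V "1 / (2 * real ?N)"]
    by (simp add: sum_distrib_left[symmetric] sum_diff1)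
  also have "\<dots> < real (card ?\<Omega>)"
  proof -
    have "(1 + 1 / (2 * real ?N)) ^ ?N \<le> exp (1 / (2 * real ?N)) ^ ?N"
      by (intro power_mono) (auto simp: exp_ge_add_one_self)
    also have "\<dots> = exp (1 / 2)" using N by (simp flip: exp_of_nat_mult)
    also have "\<dots> < 2"
    proof -
      have "exp (1 / 2 :: real) \<le> 1 + 1 / 2 + (1 / 2)\<^sup>2" by (rule exp_bound) auto
      then show ?thesis by (simp add: power2_eq_square)
    qed
    finally show ?thesis using \<Omega>pos by simp
  qed
  finally have "card (\<Union>S\<in>\<B>. Bad S) < card ?\<Omega>" by simp
  then obtain f where f: "f \<in> ?\<Omega>" "f \<notin> (\<Union>S\<in>\<B>. Bad S)"
    by (metis (no_types, lifting) card_mono fin\<B> fin\<Omega> finite_UN finite_subset leD subsetI Bad_def mem_Collect_eq)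
  show ?thesis
  proof (intro exI[of _ "\<lambda>x i. f (x, i)"] conjI ballI allI impI)
    show "f (x, i) < h" if "x \<in> V" "i < 8 * D" for x i
      using f(1) that by (auto simp: PiE_def Pi_def)
    show "6 * D * card S < card ((\<lambda>(x, i). f (x, i)) ` (S \<times> {..<8 * D}))"
      if "S \<subseteq> V" "S \<noteq> {}" "D * card S \<le> M" for S
      using f that by (auto simp: \<B>_def Bad_def not_le)
  qed
qed

section \<open>A circuit with independent past and future\<close>

text \<open>The circuit has \<open>m\<close> registers. Time is divided into blocks of \<open>m * m\<close> steps; step
  \<open>g * (m * m) + j * m + i\<close> adds register \<open>i\<close> to register \<open>j\<close> if the step belongs to \<open>\<omega>\<close> and \<open>i \<noteq> j\<close>.
  Vertex \<open>(s, j)\<close> is the content of register \<open>j\<close> at time \<open>s\<close>.\<close>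

definition row :: "nat \<Rightarrow> nat \<Rightarrow> nat" where "row m s = (s mod (m * m)) div m"
definition col :: "nat \<Rightarrow> nat \<Rightarrow> nat" where "col m s = s mod m"
definition active :: "nat \<Rightarrow> nat set \<Rightarrow> nat \<Rightarrow> bool" where
  "active m \<omega> s \<longleftrightarrow> s \<in> \<omega> \<and> row m s \<noteq> col m s"

lemma col_less: "0 < m \<Longrightarrow> col m s < m" by (simp add: col_def)

lemma row_less: "0 < m \<Longrightarrow> row m s < m"
  by (simp add: row_def less_mult_imp_div_less)

lemma row_col_eq: "i < m \<Longrightarrow> j < m \<Longrightarrow> row m (g * (m * m) + j * m + i) = j \<and> col m (g * (m * m) + j * m + i) = i"
proof -
  assume ij: "i < m" "j < m"
  then have "(j + 1) * m \<le> m * m" by (intro mult_right_mono) auto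
  then have "j * m + i < m * m" using ij by simp
  then show ?thesis using ij
    by (simp add: row_def col_def add.assoc mod_mult_self3) (metis mod_mult_self3 mod_less add.assoc mult.assoc)
qed

text \<open>\<open>coef m \<omega> a t j\<close> expresses the content of register \<open>j\<close> at time \<open>a + t\<close> in terms of the
  contents of all registers at time \<open>a\<close>.\<close>

primrec coef :: "nat \<Rightarrow> nat set \<Rightarrow> nat \<Rightarrow> nat \<Rightarrow> nat \<Rightarrow> nat \<Rightarrow> bit" where
  "coef m \<omega> a 0 = (\<lambda>j i. of_bool (i = j))"
| "coef m \<omega> a (Suc t) = (\<lambda>j i. coef m \<omega> a t j i +
     (if j = row m (a + t) \<and> active m \<omega> (a + t) then coef m \<omega> a t (col m (a + t)) i else 0))"

text \<open>A linear form in formal initial contents. The actual sources are \<open>0\<close>, but a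
  run seen only above some block may start from anything, and applying a functional to the forms
  evaluates such a run.\<close>

definition form :: "nat \<Rightarrow> nat set \<Rightarrow> nat \<times> nat \<Rightarrow> nat \<Rightarrow> bit" where
  "form m \<omega> v = coef m \<omega> 0 (fst v) (snd v)"

lemma form_Suc: "form m \<omega> (Suc s, j) i = form m \<omega> (s, j) i +
     (if j = row m s \<and> active m \<omega> s then form m \<omega> (s, col m s) i else 0)"
  by (simp add: form_def)

lemma coef_cong:
  assumes "\<And>s. a \<le> s \<Longrightarrow> s < a + t \<Longrightarrow> s \<in> \<omega> \<longleftrightarrow> s \<in> \<omega>'"
  shows "coef m \<omega> a t = coef m \<omega>' a t"
  using assms by (induction t) (auto simp: active_def fun_eq_iff)

lemma form_cong:
  assumes "\<And>s. s < fst v \<Longrightarrow> s \<in> \<omega> \<longleftrightarrow> s \<in> \<omega>'"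
  shows "form m \<omega> v = form m \<omega>' v"
  using coef_cong[of 0 "fst v" \<omega> \<omega>' m] assms by (simp add: form_def)

lemma form_compose:
  assumes "0 < m" "j < m"
  shows "form m \<omega> (a + t, j) z = (\<Sum>i<m. coef m \<omega> a t j i * form m \<omega> (a, i) z)"
  using assms(2)
proof (induction t arbitrary: j)
  case 0
  have "(\<Sum>i<m. coef m \<omega> a 0 j i * form m \<omega> (a, i) z) = (\<Sum>i<m. if i = j then form m \<omega> (a, j) z else 0)"
    by (intro sum.cong) auto
  then show ?case using 0 by simp
next
  case (Suc t)
  show ?case
    using Suc.IH[OF Suc.prems] Suc.IH[OF col_less[OF assms(1), of "a + t"]]
    by (cases "j = row m (a + t) \<and> active m \<omega> (a + t)")
      (auto simp: form_Suc distrib_right sum.distrib)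
qed

text \<open>An active step adds one register to a different one and is invertible, so the registers
  stay linearly independent. The induction pulls the coefficients back through the last
  step.\<close>

lemma form_independent:
  assumes m: "0 < m" and "\<And>z. (\<Sum>i<m. c i * form m \<omega> (s, i) z) = 0" and "i < m"
  shows "c i = 0"
  using assms(2,3)
proof (induction s arbitrary: c i)
  case 0
  have "(\<Sum>j<m. c j * form m \<omega> (0, j) i) = (\<Sum>j<m. if j = i then c i else 0)"
    by (intro sum.cong) (auto simp: form_def)
  then show ?case using 0 by simp
next
  case (Suc s)
  let ?r = "row m s" and ?l = "col m s"
  have rl: "?r < m" "?l < m" using m by (simp_all add: row_less col_less)
  show ?case
  proof (cases "active m \<omega> s")
    case True
    define c' where "c' = c(?l := c ?l + c ?r)"
    have ne: "?r \<noteq> ?l" using True by (simp add: active_def)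
    have "(\<Sum>i<m. c' i * form m \<omega> (s, i) z) = 0" for z
    proof -
      have "(\<Sum>i<m. c' i * form m \<omega> (s, i) z) =
          (\<Sum>i<m. c i * form m \<omega> (s, i) z + (if i = ?l then c ?r * form m \<omega> (s, ?l) z else 0))"
        by (intro sum.cong) (auto simp: c'_def distrib_right)
      also have "\<dots> = (\<Sum>i<m. c i * form m \<omega> (s, i) z) + c ?r * form m \<omega> (s, ?l) z"
        using rl by (simp add: sum.distrib)
      also have "\<dots> = (\<Sum>i<m. c i * form m \<omega> (s, i) z + (if i = ?r then c ?r * form m \<omega> (s, ?l) z else 0))"
        using rl by (simp add: sum.distrib)
      also have "\<dots> = (\<Sum>i<m. c i * form m \<omega> (Suc s, i) z)"
        using True by (intro sum.cong) (auto simp: form_Suc distrib_left)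
      finally show ?thesis using Suc.prems(1) by simp
    qed
    from Suc.IH[OF this] have c': "c' i = 0" if "i < m" for i using that .
    have "c ?r = 0" using c'[OF rl(1)] ne by (simp add: c'_def)
    then show ?thesis using c'[OF Suc.prems(2)] by (cases "i = ?l") (auto simp: c'_def)
  next
    case False
    then have "form m \<omega> (Suc s, j) z = form m \<omega> (s, j) z" for j z by (simp add: form_Suc)
    then show ?thesis using Suc.IH[of c i] Suc.prems by simp
  qed
qed

text \<open>In these steps register \<open>j\<close> is the only target and never a summand, so what
  is added are the contents at time \<open>a\<close>.\<close>

lemma form_row:
  assumes "j < m" "t \<le> m" and a: "a = g * (m * m) + j * m"
  shows "form m \<omega> (a + t, i) z = form m \<omega> (a, i) z +
     (if i = j then \<Sum>l<t. of_bool (a + l \<in> \<omega> \<and> l \<noteq> j) * form m \<omega> (a, l) z else 0)"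
  using assms(2)
proof (induction t arbitrary: i)
  case (Suc t)
  then have rc: "row m (a + t) = j" "col m (a + t) = t" using row_col_eq[of t m j g] assms(1) a by auto
  show ?case
    using Suc rc by (auto simp: form_Suc active_def add.assoc)
qed simp

lemma form_later_rows:
  assumes "j < m" "i \<le> j" "j * m + m + t \<le> m * m"
  shows "form m \<omega> (g * (m * m) + j * m + m + t, i) z = form m \<omega> (g * (m * m) + j * m + m, i) z"
  using assms(3)
proof (induction t)
  case (Suc t)
  have "row m (g * (m * m) + j * m + m + t) = (j * m + m + t) div m"
    using Suc.prems by (simp add: row_def add.assoc mod_mult_self3)
  also have "\<dots> > j"
  proof -
    have "(Suc j * m) div m \<le> (j * m + m + t) div m" by (intro div_le_mono) simp
    then show ?thesis using assms(1) by simp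
  qed
  finally show ?case using Suc assms(2) by (simp add: form_Suc)
qed simp

definition spread :: "nat \<Rightarrow> nat set \<Rightarrow> (nat \<times> nat) set \<Rightarrow> nat \<Rightarrow> bit" where
  "spread m \<omega> Z z = (\<Sum>v\<in>Z. form m \<omega> v z)"

text \<open>Coordinates of the sum over \<open>Z\<close> in the registers at time \<open>a\<close>;
  they depend only on steps from \<open>a\<close> on. The truncated \<open>fst v - a\<close> is
  meaningful for vertices at time \<open>a\<close> or later, where it is used.\<close>

definition rel_coef :: "nat \<Rightarrow> nat set \<Rightarrow> nat \<Rightarrow> (nat \<times> nat) set \<Rightarrow> nat \<Rightarrow> bit" where
  "rel_coef m \<omega> a Z i = (\<Sum>v\<in>Z. coef m \<omega> a (fst v - a) (snd v) i)"

lemma spread_rel_coef: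
  assumes "0 < m" "\<And>v. v \<in> Z \<Longrightarrow> a \<le> fst v \<and> snd v < m"
  shows "spread m \<omega> Z z = (\<Sum>i<m. rel_coef m \<omega> a Z i * form m \<omega> (a, i) z)"
proof -
  have "spread m \<omega> Z z = (\<Sum>v\<in>Z. \<Sum>i<m. coef m \<omega> a (fst v - a) (snd v) i * form m \<omega> (a, i) z)"
    unfolding spread_def
  proof (rule sum.cong)
    fix v assume "v \<in> Z"
    then have "a \<le> fst v" "snd v < m" using assms(2) by auto
    then show "form m \<omega> v z = (\<Sum>i<m. coef m \<omega> a (fst v - a) (snd v) i * form m \<omega> (a, i) z)"
      using form_compose[OF assms(1), of "snd v" \<omega> a "fst v - a" z] by simp
  qed simp
  also have "\<dots> = (\<Sum>i<m. rel_coef m \<omega> a Z i * form m \<omega> (a, i) z)"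
    by (subst sum.swap) (simp add: rel_coef_def sum_distrib_right)
  finally show ?thesis .
qed

definition collisions :: "nat \<Rightarrow> nat \<Rightarrow> nat \<Rightarrow> (nat \<times> nat) set \<Rightarrow> (nat \<times> nat) set \<Rightarrow> nat set set" where
  "collisions m g j Zl Zh = {\<omega>. (\<forall>v\<in>Zl. fst v \<le> g * (m * m)) \<and>
     (\<forall>v\<in>Zh. Suc g * (m * m) \<le> fst v \<and> snd v < m) \<and> spread m \<omega> Zl = spread m \<omega> Zh \<and>
     rel_coef m \<omega> (Suc g * (m * m)) Zh j = 1 \<and>
     (\<forall>i. j < i \<longrightarrow> i < m \<longrightarrow> rel_coef m \<omega> (Suc g * (m * m)) Zh i = 0)}"

text \<open>If register \<open>j\<close> is the last one that the upper vertices depend on at the end of block \<open>g\<close>,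
  then a collision determines the random row added to register \<open>j\<close> in this block from all other bits.\<close>

lemma collisions_inj:
  assumes j: "j < m"
    and \<omega>: "\<omega> \<in> collisions m g j Zl Zh" and \<omega>': "\<omega>' \<in> collisions m g j Zl Zh"
    and agree: "\<omega> - (\<lambda>i. g * (m * m) + j * m + i) ` ({..<m} - {j}) = \<omega>' - (\<lambda>i. g * (m * m) + j * m + i) ` ({..<m} - {j})"
  shows "\<omega> = \<omega>'"
proof -
  let ?M = "m * m"
  let ?a = "g * ?M + j * m"
  let ?J = "(\<lambda>i. ?a + i) ` ({..<m} - {j})"
  let ?b = "Suc g * ?M"
  have m: "0 < m" using j by simp
  have jm: "j * m + m \<le> ?M"
  proof -
    have "Suc j * m \<le> m * m" using j by (intro mult_right_mono) auto
    then show ?thesis by simp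
  qed
  have off: "s \<in> \<omega> \<longleftrightarrow> s \<in> \<omega>'" if "s \<notin> ?J" for s using agree that by blast
  have before: "s \<in> \<omega> \<longleftrightarrow> s \<in> \<omega>'" if "s < ?a" for s using that by (intro off) auto
  have after: "s \<in> \<omega> \<longleftrightarrow> s \<in> \<omega>'" if "?b \<le> s" for s
    using that jm by (intro off) auto
  have Zl: "fst v \<le> g * ?M" if "v \<in> Zl" for v using \<omega> that by (auto simp: collisions_def)
  have Zh: "?b \<le> fst v \<and> snd v < m" if "v \<in> Zh" for v using \<omega> that by (auto simp: collisions_def)
  have low: "spread m \<omega> Zl = spread m \<omega>' Zl"
  proof
    fix z
    show "spread m \<omega> Zl z = spread m \<omega>' Zl z"
      unfolding spread_def
    proof (rule sum.cong)
      fix v assume v: "v \<in> Zl"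
      have "form m \<omega> v = form m \<omega>' v"
        using Zl[OF v] by (intro form_cong before) auto
      then show "form m \<omega> v z = form m \<omega>' v z" by simp
    qed simp
  qed
  have "coef m \<omega> ?b t = coef m \<omega>' ?b t" for t by (intro coef_cong after)
  then have w: "rel_coef m \<omega> ?b Zh = rel_coef m \<omega>' ?b Zh"
    by (simp add: rel_coef_def fun_eq_iff)
  define w where "w = rel_coef m \<omega> ?b Zh"
  have wj: "w j = 1" "\<And>i. j < i \<Longrightarrow> i < m \<Longrightarrow> w i = 0"
    using \<omega> by (auto simp: collisions_def w_def)
  have ha: "form m \<omega> (?a, i) = form m \<omega>' (?a, i)" for i by (intro form_cong before) auto
  \<comment> \<open>At the end of the block only registers up to \<open>j\<close> matter, and the
    rows after row \<open>j\<close> no longer touch them. From time \<open>?a\<close> on, the block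
    therefore enters only through row \<open>j\<close>.\<close>
  have high: "spread m \<chi> Zh z = (\<Sum>i<Suc j. w i * form m \<chi> (?a, i) z) +
       (\<Sum>l<m. of_bool (?a + l \<in> \<chi> \<and> l \<noteq> j) * form m \<chi> (?a, l) z)"
    if "\<chi> = \<omega> \<or> \<chi> = \<omega>'" for \<chi> z
  proof -
    have endb: "form m \<chi> (?b, i) z = form m \<chi> (?a, i) z + (if i = j then
        (\<Sum>l<m. of_bool (?a + l \<in> \<chi> \<and> l \<noteq> j) * form m \<chi> (?a, l) z) else 0)" if "i \<le> j" for i
    proof -
      have "?b = ?a + m + (?M - (j * m + m))" using jm by simp
      then have "form m \<chi> (?b, i) z = form m \<chi> (?a + m, i) z"
        using form_later_rows[OF j that, of "?M - (j * m + m)" \<chi> g z] jm by (simp add: add.commute)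
      then show ?thesis using form_row[OF j le_refl refl, of \<chi> g i z] by simp
    qed
    have "spread m \<chi> Zh z = (\<Sum>i<m. w i * form m \<chi> (?b, i) z)"
      using spread_rel_coef[OF m Zh, of Zh \<chi> z] that w by (auto simp: w_def)
    also have "\<dots> = (\<Sum>i<Suc j. w i * form m \<chi> (?b, i) z)"
      using j wj(2) by (intro sum.mono_neutral_right) auto
    also have "\<dots> = (\<Sum>i<Suc j. w i * form m \<chi> (?a, i) z + (if i = j then
        (\<Sum>l<m. of_bool (?a + l \<in> \<chi> \<and> l \<noteq> j) * form m \<chi> (?a, l) z) else 0))"
      using endb wj(1) by (intro sum.cong) (auto simp: distrib_left)
    finally show ?thesis by (simp only: sum.distrib) (simp add: sum.delta)
  qed
  \<comment> \<open>The lower sums see only earlier steps and agree, so the upper sums agree as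
    well. Hence the difference of the two random rows is a vanishing combination of independent
    forms.\<close>
  have "spread m \<omega> Zh = spread m \<omega>' Zh" using \<omega> \<omega>' low by (simp add: collisions_def)
  then have "(\<Sum>l<m. of_bool (?a + l \<in> \<omega> \<and> l \<noteq> j) * form m \<omega> (?a, l) z) =
      (\<Sum>l<m. of_bool (?a + l \<in> \<omega>' \<and> l \<noteq> j) * form m \<omega> (?a, l) z)" for z
    using high[of \<omega> z] high[of \<omega>' z] by (simp add: ha)
  then have "(\<Sum>l<m. (of_bool (?a + l \<in> \<omega> \<and> l \<noteq> j) + of_bool (?a + l \<in> \<omega>' \<and> l \<noteq> j)) * form m \<omega> (?a, l) z) = 0" for z
    by (simp add: distrib_right sum.distrib)
  from form_independent[OF m this] have eq0: "of_bool (?a + l \<in> \<omega> \<and> l \<noteq> j) + of_bool (?a + l \<in> \<omega>' \<and> l \<noteq> j) = (0::bit)"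
    if "l < m" for l using that .
  have on: "?a + l \<in> \<omega> \<longleftrightarrow> ?a + l \<in> \<omega>'" if "l < m" "l \<noteq> j" for l
    using eq0[OF that(1)] that(2) by (simp add: of_bool_def split: if_splits)
  show "\<omega> = \<omega>'"
  proof (rule set_eqI)
    fix s show "s \<in> \<omega> \<longleftrightarrow> s \<in> \<omega>'"
    proof (cases "s \<in> ?J")
      case True
      then show ?thesis using on by auto
    qed (rule off)
  qed
qed

lemma card_collisions:
  assumes "j < m" "g < G"
  shows "card (collisions m g j Zl Zh \<inter> Pow {..<G * (m * m)}) \<le> 2 ^ (G * (m * m) - (m - 1))"
proof -
  let ?J = "(\<lambda>i. g * (m * m) + j * m + i) ` ({..<m} - {j})"
  let ?S = "G * (m * m)"
  have J: "?J \<subseteq> {..<?S}"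
  proof -
    have "Suc j * m \<le> m * m" using assms by (intro mult_right_mono) auto
    moreover have "Suc g * (m * m) \<le> G * (m * m)" using assms by (intro mult_right_mono) auto
    ultimately show ?thesis by auto
  qed
  have cJ: "card ?J = m - 1" using assms by (subst card_image) (auto simp: inj_on_def)
  have "inj_on (\<lambda>\<omega>. \<omega> - ?J) (collisions m g j Zl Zh \<inter> Pow {..<?S})"
    using collisions_inj[OF assms(1)] by (intro inj_onI) blast
  moreover have "(\<lambda>\<omega>. \<omega> - ?J) ` (collisions m g j Zl Zh \<inter> Pow {..<?S}) \<subseteq> Pow ({..<?S} - ?J)" by auto
  ultimately have "card (collisions m g j Zl Zh \<inter> Pow {..<?S}) \<le> card (Pow ({..<?S} - ?J))"
    by (intro card_inj_on_le) auto
  also have "\<dots> = 2 ^ (?S - (m - 1))" using J cJ by (simp add: card_Pow card_Diff_subset finite_subset)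
  finally show ?thesis .
qed

definition separating :: "nat \<Rightarrow> nat \<Rightarrow> nat \<Rightarrow> nat set \<Rightarrow> bool" where
  "separating m G p \<omega> \<longleftrightarrow> (\<forall>g<G. \<forall>Zl Zh. Zl \<subseteq> {..G * (m * m)} \<times> {..<m} \<longrightarrow> Zh \<subseteq> {..G * (m * m)} \<times> {..<m} \<longrightarrow>
     card Zl \<le> p \<longrightarrow> card Zh \<le> p \<longrightarrow>
     (\<forall>v\<in>Zl. fst v \<le> g * (m * m)) \<longrightarrow> (\<forall>v\<in>Zh. Suc g * (m * m) \<le> fst v) \<longrightarrow>
     spread m \<omega> Zl = spread m \<omega> Zh \<longrightarrow> (\<forall>z. spread m \<omega> Zh z = 0))"

text \<open>Each event \<open>collisions\<close> contains at most one in \<open>2 ^ (m - 1)\<close>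
  wirings, and the left side of \<open>bound\<close> counts the events: a block, a last register and
  two vertex sets.\<close>

lemma separating_exists:
  assumes m: "0 < m" and bound: "G * m * (((G * (m * m) + 1) * m + 1) ^ p) ^ 2 < 2 ^ (m - 1)"
    and G: "0 < G"
  shows "\<exists>\<omega>. separating m G p \<omega>"
proof -
  let ?S = "G * (m * m)"
  let ?V = "{..?S} \<times> {..<m}"
  \<comment> \<open>Lists padded with \<open>None\<close> stand for sets of at most \<open>p\<close>
    vertices; overcounting does no harm.\<close>
  define Ls where "Ls = {l. set l \<subseteq> insert None (Some ` ?V) \<and> length l = p}"
  define sup where "sup l = {v. Some v \<in> set l}" for l :: "(nat \<times> nat) option list"
  have cV: "card (insert None (Some ` ?V)) = (?S + 1) * m + 1"
    by (subst card_insert_disjoint) (auto simp: card_image card_cartesian_product)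
  have Ls: "finite Ls" "card Ls = ((?S + 1) * m + 1) ^ p"
    unfolding Ls_def using finite_lists_length_eq[of "insert None (Some ` ?V)" p]
      card_lists_length_eq[of "insert None (Some ` ?V)" p] cV by auto
  define I where "I = {..<G} \<times> {..<m} \<times> Ls \<times> Ls"
  define Bad where "Bad = (\<lambda>(g, j, l, l'). collisions m g j (sup l) (sup l') \<inter> Pow {..<?S})"
  have I: "finite I" "card I = G * m * (((?S + 1) * m + 1) ^ p) ^ 2"
    unfolding I_def using Ls by (auto simp: card_cartesian_product power2_eq_square)
  have "card (\<Union>x\<in>I. Bad x) \<le> (\<Sum>x\<in>I. card (Bad x))" by (rule card_UN_le[OF I(1)])
  also have "\<dots> \<le> (\<Sum>x\<in>I. 2 ^ (?S - (m - 1)))"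
  proof (rule sum_mono)
    fix x assume "x \<in> I"
    then obtain g j l l' where "x = (g, j, l, l')" "g < G" "j < m" by (auto simp: I_def)
    then show "card (Bad x) \<le> 2 ^ (?S - (m - 1))"
      using card_collisions[of j m g G "sup l" "sup l'"] by (simp add: Bad_def)
  qed
  also have "\<dots> < 2 ^ (m - 1) * 2 ^ (?S - (m - 1))"
    using bound by (simp add: I(2))
  also have "\<dots> = 2 ^ ?S"
  proof -
    have "1 * (1 * m) \<le> G * (m * m)" using G m by (intro mult_le_mono) auto
    then have "m - 1 + (?S - (m - 1)) = ?S" by linarith
    then show ?thesis by (simp only: power_add[symmetric])
  qed
  also have "\<dots> = card (Pow {..<?S})" by (simp add: card_Pow)
  finally have "\<not> Pow {..<?S} \<subseteq> (\<Union>x\<in>I. Bad x)"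
    using I(1) by (auto simp: Bad_def not_le dest!: card_mono[rotated])
  then obtain \<omega> where \<omega>: "\<omega> \<subseteq> {..<?S}" "\<And>x. x \<in> I \<Longrightarrow> \<omega> \<notin> Bad x" by auto
  have list: "\<exists>l\<in>Ls. sup l = Z" if Z: "Z \<subseteq> ?V" "card Z \<le> p" for Z
  proof -
    have "finite Z" using Z finite_subset by blast
    then obtain zs where zs: "set zs = Z" "distinct zs" using finite_distinct_list by blast
    then have "length zs \<le> p" using Z distinct_card by metis
    then have "map Some zs @ replicate (p - length zs) None \<in> Ls"
      using zs Z by (auto simp: Ls_def)
    moreover have "sup (map Some zs @ replicate (p - length zs) None) = Z"
      using zs by (auto simp: sup_def)
    ultimately show ?thesis by blast
  qed
  have "separating m G p \<omega>"
    unfolding separating_def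
  proof (intro allI impI)
    fix g Zl Zh z
    assume g: "g < G" and Z: "Zl \<subseteq> ?V" "Zh \<subseteq> ?V" "card Zl \<le> p" "card Zh \<le> p"
      and lev: "\<forall>v\<in>Zl. fst v \<le> g * (m * m)" "\<forall>v\<in>Zh. Suc g * (m * m) \<le> fst v"
      and eq: "spread m \<omega> Zl = spread m \<omega> Zh"
    let ?b = "Suc g * (m * m)"
    show "spread m \<omega> Zh z = 0"
    proof (rule ccontr)
      assume nz: "spread m \<omega> Zh z \<noteq> 0"
      \<comment> \<open>A nonzero upper sum depends on some register at the end of the block; the
        last such register puts \<open>\<omega>\<close> into a forbidden event.\<close>
      define T where "T = {i. i < m \<and> rel_coef m \<omega> ?b Zh i = 1}"
      have exp: "spread m \<omega> Zh z = (\<Sum>i<m. rel_coef m \<omega> ?b Zh i * form m \<omega> (?b, i) z)"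
        using lev(2) Z(2) by (intro spread_rel_coef[OF m]) auto
      have "T \<noteq> {}"
      proof
        assume "T = {}"
        then have "\<And>i. i < m \<Longrightarrow> rel_coef m \<omega> ?b Zh i = 0" by (auto simp: T_def)
        then show False using nz exp by simp
      qed
      moreover have finT: "finite T" by (simp add: T_def)
      ultimately have j: "Max T \<in> T" by simp
      then have jm: "Max T < m" by (simp only: T_def mem_Collect_eq)
      have top: "rel_coef m \<omega> ?b Zh i = 0" if "Max T < i" "i < m" for i
        using that Max_ge[OF finT, of i] by (fastforce simp: T_def)
      have "\<forall>v\<in>Zh. ?b \<le> fst v \<and> snd v < m" using lev(2) Z(2) by auto
      moreover have "rel_coef m \<omega> ?b Zh (Max T) = 1" using j by (simp only: T_def mem_Collect_eq)
      ultimately have "\<omega> \<in> collisions m g (Max T) Zl Zh"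
        unfolding collisions_def mem_Collect_eq using lev(1) eq top by blast
      moreover obtain l l' where "l \<in> Ls" "l' \<in> Ls" "sup l = Zl" "sup l' = Zh"
        using list Z by metis
      ultimately show False
        using \<omega>(2)[of "(g, Max T, l, l')"] \<omega>(1) g jm by (simp add: I_def Bad_def)
    qed
  qed
  then show ?thesis by blast
qed

section \<open>Linear functionals on bit vectors\<close>

definition vscale :: "bit \<Rightarrow> (nat \<Rightarrow> bit) \<Rightarrow> nat \<Rightarrow> bit" where
  "vscale c f = (\<lambda>i. c * f i)"

interpretation bitvec: vector_space_pair vscale "(*) :: bit \<Rightarrow> bit \<Rightarrow> bit"
  by unfold_locales (auto simp: vscale_def fun_eq_iff algebra_simps)

abbreviation functional :: "((nat \<Rightarrow> bit) \<Rightarrow> bit) \<Rightarrow> bool" where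
  "functional \<equiv> Vector_Spaces.linear vscale (*)"

lemma bitvec_add_self [simp]: "(f :: nat \<Rightarrow> bit) + f = 0"
  by (simp add: fun_eq_iff)

text \<open>Scalars are \<open>0\<close> or \<open>1\<close>, so linear combinations are subset
  sums. This links \<open>separating\<close>, which speaks of vertex sets, to spans.\<close>

lemma span_image_bitvec:
  assumes "finite X" "u \<in> bitvec.vs1.span (\<phi> ` X)"
  shows "\<exists>Z\<subseteq>X. u = sum \<phi> Z"
  using assms(2)
proof (induction rule: bitvec.vs1.span_induct_alt)
  case base
  show ?case by (intro exI[of _ "{}"]) auto
next
  case (step c x y)
  then obtain v Z where v: "v \<in> X" "x = \<phi> v" and Z: "Z \<subseteq> X" "y = sum \<phi> Z" by auto
  have fin: "finite Z" using Z assms(1) finite_subset by blast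
  show ?case
  proof (cases c)
    case zero
    then have "vscale c x + y = y" by (simp add: vscale_def fun_eq_iff)
    then show ?thesis using Z by auto
  next
    case one
    then have eq: "vscale c x + y = \<phi> v + sum \<phi> Z" using v Z by (simp add: vscale_def fun_eq_iff)
    show ?thesis
    proof (cases "v \<in> Z")
      case True
      have "\<phi> v + sum \<phi> Z = (\<phi> v + \<phi> v) + sum \<phi> (Z - {v})"
        using sum.remove[OF fin True, of \<phi>] by (simp only: add.assoc)
      then have "\<phi> v + sum \<phi> Z = sum \<phi> (Z - {v})" by simp
      then show ?thesis using eq Z by (intro exI[of _ "Z - {v}"]) auto
    next
      case False
      then show ?thesis using eq Z v fin by (intro exI[of _ "insert v Z"]) auto
    qed
  qed
qed

text \<open>By \<open>sep\<close> the spans of the two families meet only in \<open>0\<close>, so a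
  functional can be prescribed independently on each.\<close>

lemma functional_split:
  assumes fin: "finite X" "finite Y"
    and sep: "\<And>Zl Zh. Zl \<subseteq> X \<Longrightarrow> Zh \<subseteq> Y \<Longrightarrow> sum \<phi> Zl = sum \<phi> Zh \<Longrightarrow> sum \<phi> Zh = 0"
    and lin: "functional \<mu>"
  obtains \<mu>' where "functional \<mu>'" "\<And>x. x \<in> X \<Longrightarrow> \<mu>' (\<phi> x) = 0" "\<And>y. y \<in> Y \<Longrightarrow> \<mu>' (\<phi> y) = \<mu> (\<phi> y)"
proof -
  let ?span = bitvec.vs1.span
  obtain B1 where B1: "B1 \<subseteq> \<phi> ` X" "bitvec.vs1.independent B1" "\<phi> ` X \<subseteq> ?span B1"
    using bitvec.vs1.maximal_independent_subset[of "\<phi> ` X"] by blast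
  obtain B where B: "B1 \<subseteq> B" "B \<subseteq> \<phi> ` X \<union> \<phi> ` Y" "bitvec.vs1.independent B" "\<phi> ` X \<union> \<phi> ` Y \<subseteq> ?span B"
    using bitvec.vs1.maximal_independent_subset_extend[of B1 "\<phi> ` X \<union> \<phi> ` Y"] B1 by blast
  have BY: "B - B1 \<subseteq> \<phi> ` Y"
  proof
    fix b assume b: "b \<in> B - B1"
    show "b \<in> \<phi> ` Y"
    proof (rule ccontr)
      assume "b \<notin> \<phi> ` Y"
      then have "b \<in> ?span B1" using b B(2) B1(3) by blast
      then have "b \<in> ?span (B - {b})" using bitvec.vs1.span_mono[of B1 "B - {b}"] b B(1) by blast
      then show False using B(3) b unfolding bitvec.vs1.dependent_def by blast
    qed
  qed
  obtain \<mu>' where l': "functional \<mu>'" "\<And>b. b \<in> B \<Longrightarrow> \<mu>' b = (if b \<in> B1 then 0 else \<mu> b)"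
    using bitvec.linear_independent_extend[OF B(3), of "\<lambda>b. if b \<in> B1 then 0 else \<mu> b"] by blast
  have zero: "\<mu>' u = 0" if "u \<in> ?span B1" for u
  proof (rule bitvec.linear_eq_on[OF l'(1) bitvec.linear_zero that])
    show "\<mu>' b = 0" if "b \<in> B1" for b using l'(2)[of b] that B(1) by auto
  qed
  have same: "\<mu>' u = \<mu> u" if "u \<in> ?span (B - B1)" for u
    by (rule bitvec.linear_eq_on[OF l'(1) lin that]) (use l'(2) in auto)
  show thesis
  proof (rule that[OF l'(1)])
    show "\<mu>' (\<phi> x) = 0" if "x \<in> X" for x using that B1(3) by (intro zero) auto
    show "\<mu>' (\<phi> y) = \<mu> (\<phi> y)" if y: "y \<in> Y" for y
    proof -
      have "\<phi> y \<in> ?span (B1 \<union> (B - B1))" using B(1,4) y by (auto simp: Un_absorb1)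
      then obtain a b where ab: "\<phi> y = a + b" "a \<in> ?span B1" "b \<in> ?span (B - B1)"
        unfolding bitvec.vs1.span_Un by blast
      have "b \<in> ?span (\<phi> ` Y)" using ab(3) bitvec.vs1.span_mono[OF BY] by blast
      moreover have "\<phi> y \<in> ?span (\<phi> ` Y)" using y by (intro bitvec.vs1.span_base) auto
      ultimately have "\<phi> y - b \<in> ?span (\<phi> ` Y)" by (intro bitvec.vs1.span_diff)
      then have "a \<in> ?span (\<phi> ` Y)" using ab(1) by simp
      moreover have "a \<in> ?span (\<phi> ` X)" using ab(2) bitvec.vs1.span_mono[OF B1(1)] by blast
      ultimately have "a = 0"
        using span_image_bitvec[OF fin(1), of a \<phi>] span_image_bitvec[OF fin(2), of a \<phi>] sep by metis
      then show ?thesis using ab same by simp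
    qed
  qed
qed

section \<open>Duplicator's strategy on the circuit\<close>

locale circuit =
  fixes m G q :: nat and \<omega> :: "nat set" and p :: nat
  assumes sep: "separating m G p \<omega>" and m: "2 \<le> m"
begin

abbreviation "\<phi> \<equiv> form m \<omega>"

definition V :: "(nat \<times> nat) set" where "V = {..G * (m * m)} \<times> {..<m}"
definition sink :: "nat \<times> nat" where "sink = (G * (m * m), 0)"

definition gate :: "nat \<Rightarrow> nat \<Rightarrow> (nat \<times> nat) list" where
  "gate s j = (Suc s, j) # (s, j) # (if j = row m s \<and> active m \<omega> s then [(s, col m s)] else [])"

definition bcons :: "((nat \<times> nat) list \<times> bit) set" where
  "bcons = insert ([sink], 1) ((\<lambda>j. ([(0, j)], 0)) ` {..<m} \<union>
     (\<lambda>(s, j). (gate s j, 0)) ` ({..<G * (m * m)} \<times> {..<m}))"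

definition low :: "nat \<Rightarrow> nat \<times> nat \<Rightarrow> bool" where "low g v \<longleftrightarrow> fst v \<le> g * (m * m)"
definition high :: "nat \<Rightarrow> nat \<times> nat \<Rightarrow> bool" where "high g v \<longleftrightarrow> Suc g * (m * m) \<le> fst v"

text \<open>Duplicator's invariant on the circuit: the position avoids the interior of some block \<open>g\<close>, is zero
  below it and follows a correct run of the circuit with output \<open>1\<close> above it. Only the inconsistency
  hidden in block \<open>g\<close> remains, and it sinks by at most \<open>2 * q\<close> blocks per round.\<close>

definition bgood :: "nat \<Rightarrow> (nat \<times> nat) set \<Rightarrow> (nat \<times> nat \<Rightarrow> bit) \<Rightarrow> bool" where
  "bgood r X \<alpha> \<longleftrightarrow> X \<subseteq> V \<and> (\<exists>g \<mu>. g < G \<and> r * q \<le> g \<and> functional \<mu> \<and> \<mu> (\<phi> sink) = 1 \<and>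
     (\<forall>x\<in>X. low g x \<and> \<alpha> x = 0 \<or> high g x \<and> \<alpha> x = \<mu> (\<phi> x)))"

lemma finite_V: "finite V" and sink_V: "sink \<in> V"
  using m by (auto simp: V_def sink_def)

lemma bcons_V: "(xs, b) \<in> bcons \<Longrightarrow> set xs \<subseteq> V"
  using m sink_V by (auto simp: bcons_def gate_def V_def col_less split: if_splits)

lemma length_bcons: "(xs, b) \<in> bcons \<Longrightarrow> length xs \<le> 3"
  by (auto simp: bcons_def gate_def split: if_splits)

lemma not_low_high: "low g x \<Longrightarrow> \<not> high g x"
proof -
  have "0 < m * m" using m by simp
  then show "low g x \<Longrightarrow> \<not> high g x" unfolding low_def high_def mult_Suc by linarith
qed

lemma high_sink: "g < G \<Longrightarrow> high g sink"
  unfolding high_def sink_def fst_conv by (intro mult_right_mono) auto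

lemma functional_add: "functional \<mu> \<Longrightarrow> \<mu> (x + y) = \<mu> x + \<mu> y"
  by (rule bitvec.linear_add)

text \<open>A gate covers one time step and a block has \<open>m * m \<ge> 2\<close> of them, so no
  gate has vertices on both sides of the avoided block. Below it all values are \<open>0\<close>;
  above it the gate is an identity of forms, which \<open>\<mu>\<close> respects.\<close>

lemma bgood_sat:
  assumes good: "bgood r X \<alpha>" and c: "(xs, b) \<in> bcons" "set xs \<subseteq> X"
  shows "(\<Sum>x\<leftarrow>xs. \<alpha> x) = b"
proof -
  obtain g \<mu> where g: "g < G" and lin: "functional \<mu>" and sink1: "\<mu> (\<phi> sink) = 1"
    and \<alpha>: "\<And>x. x \<in> X \<Longrightarrow> low g x \<and> \<alpha> x = 0 \<or> high g x \<and> \<alpha> x = \<mu> (\<phi> x)"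
    using good by (auto simp: bgood_def)
  have M: "2 \<le> m * m" using mult_le_mono[OF m m] by simp
  have lowD: "\<alpha> x = 0" if "x \<in> X" "low g x" for x using \<alpha>[OF that(1)] not_low_high that(2) by blast
  have highD: "\<alpha> x = \<mu> (\<phi> x)" if "x \<in> X" "high g x" for x using \<alpha>[OF that(1)] not_low_high that(2) by blast
  consider "xs = [sink]" "b = 1" | j where "xs = [(0, j)]" "b = 0" | s j where "xs = gate s j" "b = 0"
    using c(1) by (auto simp: bcons_def)
  then show ?thesis
  proof cases
    case 1
    then show ?thesis using highD[of sink] high_sink[OF g] sink1 c(2) by simp
  next
    case 2
    then show ?thesis using lowD[of "(0, j)"] c(2) by (simp add: low_def)
  next
    case (3 s j)
    have X: "(Suc s, j) \<in> X" "(s, j) \<in> X" using 3 c(2) by (auto simp: gate_def)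
    show ?thesis
    proof (cases "low g (Suc s, j)")
      case True
      then have "low g (s, i)" for i by (simp add: low_def)
      then show ?thesis using 3 c(2) True lowD by (auto simp: gate_def split: if_splits)
    next
      case False
      then have hi: "high g (Suc s, j)" using \<alpha>[OF X(1)] by blast
      then have "\<not> low g (s, j)" using M by (auto simp: low_def high_def)
      then have hi': "high g (s, j)" using \<alpha>[OF X(2)] by blast
      then have hi2: "high g (s, i)" for i by (simp add: high_def)
      show ?thesis
      proof (cases "j = row m s \<and> active m \<omega> s")
        case True
        then have "\<phi> (Suc s, j) = \<phi> (s, j) + \<phi> (s, col m s)" by (auto simp: form_Suc fun_eq_iff)
        then have "\<alpha> (Suc s, j) = \<mu> (\<phi> (s, j)) + \<mu> (\<phi> (s, col m s))"
          using highD[OF X(1) hi] functional_add[OF lin] by simp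
        then show ?thesis using 3 c(2) True highD[OF _ hi2] by (auto simp: gate_def)
      next
        case False
        then have "\<phi> (Suc s, j) = \<phi> (s, j)" by (auto simp: form_Suc fun_eq_iff)
        then show ?thesis using 3 False highD[OF X(1) hi] highD[OF X(2) hi'] by (auto simp: gate_def)
      qed
    qed
  qed
qed

text \<open>A vertex lies in the interior of at most one block, so fewer than \<open>q\<close>
  vertices leave one of \<open>q\<close> consecutive blocks free.\<close>

lemma free_block:
  assumes "finite X" "card X < q"
  shows "\<exists>g. r * q \<le> g \<and> g < Suc r * q \<and> (\<forall>x\<in>X. low g x \<or> high g x)"
proof (rule ccontr)
  assume none: "\<not> ?thesis"
  have "\<exists>x\<in>X. g = fst x div (m * m)" if gr: "g \<in> {r * q..<Suc r * q}" for g
  proof -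
    obtain x where x: "x \<in> X" "\<not> low g x" "\<not> high g x" using none gr by (meson atLeastLessThan_iff)
    then have "g = fst x div (m * m)"
      by (intro div_nat_eqI[symmetric]) (auto simp: low_def high_def mult.commute[of "m * m"])
    then show ?thesis using x by blast
  qed
  then have "{r * q..<Suc r * q} \<subseteq> (\<lambda>x. fst x div (m * m)) ` X" by blast
  then have "card {r * q..<Suc r * q} \<le> card X"
    using assms(1) by (meson card_image_le card_mono finite_imageI le_trans)
  then show False using assms(2) by simp
qed

text \<open>The block \<open>g'\<close> that is free for the enlarged position lies strictly below
  \<open>g\<close>. Old low vertices between the two blocks become high, so the new run must vanish
  on them and keep all old high values; separation across block \<open>g\<close> provides its
  functional.\<close>

lemma bgood_extend:
  assumes good: "bgood (Suc r) X \<alpha>" and X': "X' \<subseteq> V" and card: "card X < p" "card (X \<union> X') < q"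
  shows "\<exists>\<alpha>'. (\<forall>x\<in>X. \<alpha>' x = \<alpha> x) \<and> bgood r (X \<union> X') \<alpha>'"
proof -
  obtain g \<mu> where g: "g < G" "Suc r * q \<le> g" and lin: "functional \<mu>" and sink1: "\<mu> (\<phi> sink) = 1"
    and XV: "X \<subseteq> V" and \<alpha>: "\<And>x. x \<in> X \<Longrightarrow> low g x \<and> \<alpha> x = 0 \<or> high g x \<and> \<alpha> x = \<mu> (\<phi> x)"
    using good by (auto simp: bgood_def)
  have fin: "finite X" "finite (X \<union> X')" using XV X' finite_V finite_subset by (metis, metis Un_least)
  obtain g' where g': "r * q \<le> g'" "g' < Suc r * q" and free: "\<And>x. x \<in> X \<union> X' \<Longrightarrow> low g' x \<or> high g' x"
    using free_block[OF fin(2) card(2)] by blast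
  have gg: "g' < g" using g g' by simp
  \<comment> \<open>The sink joins the high side so that the new run still outputs \<open>1\<close>;
    it accounts for the strict \<open>card X < p\<close>.\<close>
  let ?L = "{x \<in> X. low g x}" and ?H = "insert sink {x \<in> X. high g x}"
  obtain \<mu>' where l': "functional \<mu>'" "\<And>x. x \<in> ?L \<Longrightarrow> \<mu>' (\<phi> x) = 0" "\<And>x. x \<in> ?H \<Longrightarrow> \<mu>' (\<phi> x) = \<mu> (\<phi> x)"
  proof (rule functional_split[of ?L ?H \<phi> \<mu>])
    fix Zl Zh assume Z: "Zl \<subseteq> ?L" "Zh \<subseteq> ?H" "sum \<phi> Zl = sum \<phi> Zh"
    have sp: "spread m \<omega> Z = sum \<phi> Z" for Z
      by (induction Z rule: infinite_finite_induct) (auto simp: spread_def fun_eq_iff)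
    have "card Zl \<le> card X" using Z fin by (intro card_mono) auto
    moreover have "card Zh \<le> card (insert sink X)" using Z fin by (intro card_mono) auto
    moreover have "card (insert sink X) \<le> Suc (card X)" using fin by (simp add: card_insert_if)
    ultimately have cards: "card Zl \<le> p" "card Zh \<le> p" using card by auto
    have "Zl \<subseteq> X" "Zh \<subseteq> insert sink X" using Z by auto
    then have "Zl \<subseteq> V" "Zh \<subseteq> V" using XV sink_V by blast+
    then have "Zl \<subseteq> {..G * (m * m)} \<times> {..<m}" "Zh \<subseteq> {..G * (m * m)} \<times> {..<m}"
      by (simp_all only: V_def)
    moreover have "\<forall>v\<in>Zl. fst v \<le> g * (m * m)" using Z by (auto simp: low_def)
    moreover have "\<forall>v\<in>Zh. Suc g * (m * m) \<le> fst v" using Z high_sink[OF g(1)] by (auto simp: high_def)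
    ultimately have "\<forall>z. spread m \<omega> Zh z = 0"
      using sep g(1) cards Z(3) unfolding separating_def sp by blast
    then show "sum \<phi> Zh = 0" by (simp add: sp fun_eq_iff)
  qed (use fin lin in auto)
  define \<alpha>' where "\<alpha>' x = (if low g' x then 0 else \<mu>' (\<phi> x))" for x
  have "\<alpha>' x = \<alpha> x" if x: "x \<in> X" for x
  proof (cases "low g x")
    case True
    then have "\<alpha> x = 0" using \<alpha>[OF x] not_low_high by blast
    moreover have "\<mu>' (\<phi> x) = 0" using True x l'(2) by blast
    ultimately show ?thesis by (simp add: \<alpha>'_def)
  next
    case False
    then have hi: "high g x" "\<alpha> x = \<mu> (\<phi> x)" using \<alpha>[OF x] by auto
    moreover have "\<not> low g' x"
    proof
      assume "low g' x"
      moreover have "g' * (m * m) \<le> g * (m * m)" using gg by (intro mult_right_mono) auto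
      ultimately show False using False unfolding low_def by linarith
    qed
    ultimately show ?thesis using l'(3)[of x] x by (simp add: \<alpha>'_def)
  qed
  moreover have "bgood r (X \<union> X') \<alpha>'"
    unfolding bgood_def
  proof (intro conjI exI ballI)
    show "X \<union> X' \<subseteq> V" using XV X' by blast
    show "g' < G" using gg g by simp
    show "\<mu>' (\<phi> sink) = 1" using l'(3) sink1 by simp
    show "low g' x \<and> \<alpha>' x = 0 \<or> high g' x \<and> \<alpha>' x = \<mu>' (\<phi> x)" if "x \<in> X \<union> X'" for x
      using free[OF that] by (auto simp: \<alpha>'_def)
  qed (use g' l' in auto)
  ultimately show ?thesis by blast
qed

lemma bgood_subset: "bgood r X \<alpha> \<Longrightarrow> X' \<subseteq> X \<Longrightarrow> bgood r X' \<alpha>"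
  unfolding bgood_def by (meson subset_iff)

lemma bgood_cong: "bgood r X \<alpha> \<Longrightarrow> (\<And>x. x \<in> X \<Longrightarrow> \<alpha> x = \<alpha>' x) \<Longrightarrow> bgood r X \<alpha>'"
  unfolding bgood_def by (metis (no_types, lifting))

text \<open>The form of the sink is one of \<open>m\<close> independent forms, hence nonzero, and
  some functional takes the value \<open>1\<close> on it.\<close>

lemma bgood_init: "R * q < G \<Longrightarrow> bgood R {} \<alpha>"
proof -
  assume R: "R * q < G"
  have "\<phi> sink \<noteq> 0"
  proof
    assume z: "\<phi> sink = 0"
    have "(\<Sum>i<m. of_bool (i = 0) * \<phi> (G * (m * m), i) z) = \<phi> sink z" for z
    proof -
      have "(\<Sum>i<m. of_bool (i = 0) * \<phi> (G * (m * m), i) z) = (\<Sum>i<m. if i = 0 then \<phi> sink z else 0)"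
        by (intro sum.cong) (auto simp: sink_def)
      then show ?thesis using m by simp
    qed
    then have "(\<Sum>i<m. of_bool (i = 0) * \<phi> (G * (m * m), i) z) = 0" for z using z by simp
    from form_independent[OF _ this, of 0] show False using m by simp
  qed
  then have "bitvec.vs1.independent {\<phi> sink}" by (simp add: bitvec.vs1.dependent_single)
  from bitvec.linear_independent_extend[OF this, of "\<lambda>_. 1"]
  obtain \<mu> where "functional \<mu>" "\<mu> (\<phi> sink) = 1" by auto
  then show ?thesis unfolding bgood_def using R by blast
qed

end

section \<open>Hardness condensation\<close>

lemma unique_value_exists:
  assumes fin: "finite E" and card: "card E < 2 * card (f ` E - F)"
  shows "\<exists>e\<in>E. f e \<notin> F \<and> (\<forall>e'\<in>E. f e' = f e \<longrightarrow> e' = e)"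
proof (rule ccontr)
  assume none: "\<not> ?thesis"
  let ?fib = "\<lambda>y. {e \<in> E. f e = y}"
  have two: "2 \<le> card (?fib y)" if y: "y \<in> f ` E - F" for y
  proof -
    obtain e where e: "e \<in> E" "f e = y" "y \<notin> F" using y by auto
    then obtain e' where e': "e' \<in> E" "f e' = f e" "e' \<noteq> e" using none by blast
    then have "card {e, e'} \<le> card (?fib y)" using fin e by (intro card_mono) auto
    then show ?thesis using e' by simp
  qed
  have "2 * card (f ` E - F) = (\<Sum>y\<in>f ` E - F. 2)" by simp
  also have "\<dots> \<le> (\<Sum>y\<in>f ` E - F. card (?fib y))" by (intro sum_mono two)
  also have "\<dots> = card (\<Union>y\<in>f ` E - F. ?fib y)"
    using fin by (subst card_UN_disjoint) auto
  also have "\<dots> \<le> card E" using fin by (intro card_mono) auto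
  finally show False using card by simp
qed

locale condensation =
  fixes V :: "'v set" and nb :: "'v \<Rightarrow> nat \<Rightarrow> nat" and D d R :: nat
    and bcons :: "('v list \<times> bit) set" and bgood :: "nat \<Rightarrow> 'v set \<Rightarrow> ('v \<Rightarrow> bit) \<Rightarrow> bool"
    and n :: nat and cs :: "(nat list \<times> bit) list"
  assumes finite_V: "finite V" and D: "0 < D" "D \<le> d"
    and nb_less: "\<And>x i. x \<in> V \<Longrightarrow> i < 8 * D \<Longrightarrow> nb x i < n div 2"
    and expand: "\<And>S. S \<subseteq> V \<Longrightarrow> S \<noteq> {} \<Longrightarrow> D * card S \<le> 2 * (d + 1) \<Longrightarrow>
       6 * D * card S < card ((\<lambda>(x, i). nb x i) ` (S \<times> {..<8 * D}))"
    and bcons_V: "\<And>xs b. (xs, b) \<in> bcons \<Longrightarrow> set xs \<subseteq> V"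
    and bgood_sat: "\<And>r X \<alpha> xs b. bgood r X \<alpha> \<Longrightarrow> (xs, b) \<in> bcons \<Longrightarrow> set xs \<subseteq> X \<Longrightarrow> (\<Sum>x\<leftarrow>xs. \<alpha> x) = b"
    and bgood_extend: "\<And>r X \<alpha> X'. bgood (Suc r) X \<alpha> \<Longrightarrow> X \<subseteq> V \<Longrightarrow> X' \<subseteq> V \<Longrightarrow> card X \<le> d + 1 \<Longrightarrow> card X' \<le> d + 1 \<Longrightarrow>
       \<exists>\<alpha>'. (\<forall>x\<in>X. \<alpha>' x = \<alpha> x) \<and> bgood r (X \<union> X') \<alpha>'"
    and bgood_subset: "\<And>r X X' \<alpha>. bgood r X \<alpha> \<Longrightarrow> X' \<subseteq> X \<Longrightarrow> bgood r X' \<alpha>"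
    and bgood_cong: "\<And>r X \<alpha> \<alpha>'. bgood r X \<alpha> \<Longrightarrow> (\<And>x. x \<in> X \<Longrightarrow> \<alpha> x = \<alpha>' x) \<Longrightarrow> bgood r X \<alpha>'"
    and bgood_init: "\<And>\<alpha>. bgood R {} \<alpha>"
    and cs: "set cs = (\<lambda>(xs, b). (concat (map (\<lambda>x. map (nb x) [0..<8 * D]) xs), b)) ` bcons"
begin

definition nbs :: "'v set \<Rightarrow> nat set" where
  "nbs S = (\<lambda>(x, i). nb x i) ` (S \<times> {..<8 * D})"

definition xsum :: "(nat \<Rightarrow> bit) \<Rightarrow> 'v \<Rightarrow> bit" where
  "xsum \<eta> x = (\<Sum>i<8 * D. \<eta> (nb x i))"

text \<open>The vertices whose value is essentially fixed by the variables in \<open>Y\<close>. All other small sets of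
  vertices keep so many neighbours outside that some of these are unique.\<close>

definition closure :: "nat set \<Rightarrow> 'v set \<Rightarrow> bool" where
  "closure Y X \<longleftrightarrow> X \<subseteq> V \<and> D * card X \<le> d + 1 \<and>
     (\<forall>Q\<subseteq>V - X. Q \<noteq> {} \<longrightarrow> D * card Q \<le> d + 1 \<longrightarrow> 5 * D * card Q < card (nbs Q - (Y \<union> nbs X)))"

definition Good :: "nat \<Rightarrow> nat set \<Rightarrow> (nat \<Rightarrow> bit) \<Rightarrow> bool" where
  "Good r Y \<eta> \<longleftrightarrow> (\<exists>X. closure Y X \<and> bgood r X (xsum \<eta>))"

lemma finite_nbs: "S \<subseteq> V \<Longrightarrow> finite (nbs S)"
  using finite_V by (auto simp: nbs_def intro: finite_subset)

lemma nbs_Un: "nbs (S \<union> T) = nbs S \<union> nbs T"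
  by (auto simp: nbs_def)

lemma card_le_if: "D * card X \<le> c \<Longrightarrow> card X \<le> c"
  using D(1) by (cases D) auto

lemma closureD: "closure Y X \<Longrightarrow> X \<subseteq> V" "closure Y X \<Longrightarrow> card X \<le> d + 1"
  unfolding closure_def by (elim conjE, assumption, elim conjE, erule card_le_if)

text \<open>Take a maximal set with at most \<open>5 * D * card X\<close> neighbours outside
  \<open>Y\<close>. Expansion \<open>6 * D\<close> bounds its \<open>D * card X\<close> by
  \<open>d + 1\<close>, and a violating \<open>Q\<close> could be added to it. The union may have
  twice the size, which is why expansion is required up to \<open>2 * (d + 1)\<close>.\<close>

lemma closure_exists:
  assumes Y: "finite Y" "card Y \<le> d + 1"
  shows "\<exists>X. closure Y X"
proof -
  define \<F> where "\<F> = {X. X \<subseteq> V \<and> D * card X \<le> 2 * (d + 1) \<and> card (nbs X - Y) \<le> 5 * D * card X}"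
  have "finite \<F>" by (rule finite_subset[of _ "Pow V"]) (use finite_V in \<open>auto simp: \<F>_def\<close>)
  moreover have "{} \<in> \<F>" by (simp add: \<F>_def nbs_def)
  ultimately obtain X where X: "X \<in> \<F>" and max: "\<And>X'. X' \<in> \<F> \<Longrightarrow> X \<subseteq> X' \<Longrightarrow> X' = X"
    using finite_has_maximal2[of \<F> "{}"] by metis
  have XV: "X \<subseteq> V" and finX: "finite X" using X finite_V by (auto simp: \<F>_def intro: finite_subset)
  have small: "D * card X \<le> d + 1"
  proof (cases "X = {}")
    case False
    then have "6 * D * card X < card (nbs X)" using expand[of X] X by (auto simp: \<F>_def nbs_def)
    also have "\<dots> \<le> card ((nbs X - Y) \<union> Y)" using Y finite_nbs[OF XV] by (intro card_mono) auto
    also have "\<dots> \<le> card (nbs X - Y) + card Y" by (rule card_Un_le)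
    also have "\<dots> \<le> 5 * D * card X + (d + 1)" using X Y by (auto simp: \<F>_def)
    finally show ?thesis by linarith
  qed simp
  moreover have "5 * D * card Q < card (nbs Q - (Y \<union> nbs X))"
    if Q: "Q \<subseteq> V - X" "Q \<noteq> {}" "D * card Q \<le> d + 1" for Q
  proof (rule ccontr)
    assume "\<not> ?thesis"
    then have le: "card (nbs Q - (Y \<union> nbs X)) \<le> 5 * D * card Q" by simp
    have finQ: "finite Q" using Q finite_V by (auto intro: finite_subset)
    have cardU: "card (X \<union> Q) = card X + card Q"
      using Q(1) finX finQ by (intro card_Un_disjoint) auto
    have "card (nbs (X \<union> Q) - Y) \<le> card ((nbs X - Y) \<union> (nbs Q - (Y \<union> nbs X)))"
      using finite_nbs[OF XV] finite_nbs[of Q] Q(1) by (intro card_mono) (auto simp: nbs_Un)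
    also have "\<dots> \<le> card (nbs X - Y) + card (nbs Q - (Y \<union> nbs X))" by (rule card_Un_le)
    also have "\<dots> \<le> 5 * D * card (X \<union> Q)"
      using X le unfolding cardU by (simp add: \<F>_def algebra_simps)
    finally have "X \<union> Q \<in> \<F>"
      using XV Q small unfolding \<F>_def by (auto simp: cardU algebra_simps)
    then have "X \<union> Q = X" using max by blast
    then show False using Q by auto
  qed
  ultimately show ?thesis using XV unfolding closure_def by blast
qed

text \<open>Each vertex has \<open>8 * D\<close> edges and more than half as many neighbours lie
  outside \<open>F\<close>, so one of these is hit by a single edge. Its vertex is set aside, the
  rest is solved, and this variable then corrects the vertex without touching the other
  sums.\<close>

lemma solve:
  assumes "finite Q" "Q \<subseteq> V"
    and "\<And>Q'. Q' \<subseteq> Q \<Longrightarrow> Q' \<noteq> {} \<Longrightarrow> 4 * D * card Q' < card (nbs Q' - F)"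
  shows "\<exists>\<eta>'. (\<forall>y\<in>F. \<eta>' y = \<eta> y) \<and> (\<forall>x\<in>Q. xsum \<eta>' x = \<beta> x)"
  using assms
proof (induction "card Q" arbitrary: Q)
  case 0
  then show ?case by auto
next
  case (Suc c)
  then have ne: "Q \<noteq> {}" by auto
  let ?E = "Q \<times> {..<8 * D}" and ?f = "\<lambda>(x, i). nb x i"
  have "card ?E = 2 * (4 * D * card Q)" by (simp add: card_cartesian_product)
  also have "\<dots> < 2 * card (?f ` ?E - F)" using Suc.prems(3)[of Q] ne by (simp add: nbs_def)
  finally obtain e where e: "e \<in> ?E" "?f e \<notin> F" and uniq: "\<And>e'. e' \<in> ?E \<Longrightarrow> ?f e' = ?f e \<Longrightarrow> e' = e"
    using unique_value_exists[OF finite_cartesian_product[OF Suc.prems(1) finite_lessThan], of "8 * D" ?f F]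
    by blast
  obtain x i where xi: "e = (x, i)" "x \<in> Q" "i < 8 * D" using e by auto
  define y where "y = nb x i"
  have uniq': "x' = x \<and> i' = i" if "x' \<in> Q" "i' < 8 * D" "nb x' i' = y" for x' i'
    using uniq[of "(x', i')"] that xi by (auto simp: y_def)
  have "\<exists>\<eta>'. (\<forall>y\<in>F. \<eta>' y = \<eta> y) \<and> (\<forall>x\<in>Q - {x}. xsum \<eta>' x = \<beta> x)"
    using Suc.hyps(2) Suc.prems xi by (intro Suc.hyps(1)) auto
  then obtain \<eta>1 where e1: "\<And>y. y \<in> F \<Longrightarrow> \<eta>1 y = \<eta> y" "\<And>x'. x' \<in> Q - {x} \<Longrightarrow> xsum \<eta>1 x' = \<beta> x'"
    by blast
  define \<eta>2 where "\<eta>2 = \<eta>1(y := \<eta>1 y + (xsum \<eta>1 x + \<beta> x))"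
  have "xsum \<eta>2 x' = \<beta> x'" if x': "x' \<in> Q" for x'
  proof (cases "x' = x")
    case True
    have "xsum \<eta>2 x = (\<Sum>i'<8 * D. \<eta>1 (nb x i') + (if i' = i then xsum \<eta>1 x + \<beta> x else 0))"
      unfolding xsum_def \<eta>2_def using uniq'[OF xi(2)] by (intro sum.cong) (auto simp: y_def xsum_def)
    also have "\<dots> = xsum \<eta>1 x + (xsum \<eta>1 x + \<beta> x)"
      using xi(3) by (simp add: sum.distrib xsum_def)
    finally show ?thesis using True by (simp add: add.assoc[symmetric])
  next
    case False
    then have "xsum \<eta>2 x' = xsum \<eta>1 x'"
      unfolding xsum_def \<eta>2_def using uniq'[OF x'] by (intro sum.cong) auto
    then show ?thesis using e1(2) x' False by simp
  qed
  moreover have "\<eta>2 z = \<eta> z" if "z \<in> F" for z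
    using that e e1(1) xi by (auto simp: \<eta>2_def y_def)
  ultimately show ?case by blast
qed

lemma sum_concat_nb:
  "(\<Sum>y\<leftarrow>concat (map (\<lambda>x. map (nb x) [0..<8 * D]) xs). \<eta> y) = (\<Sum>x\<leftarrow>xs. xsum \<eta> x)"
  by (induction xs) (auto simp: xsum_def interv_sum_list_conv_sum_set_nat o_def atLeast0LessThan)

text \<open>The old closure keeps its sums because all its neighbours are fixed; vertices new in the
  closure receive the values of the circuit strategy through \<open>solve\<close>.\<close>

lemma Good_extend:
  assumes good: "Good (Suc r) Y \<eta>" and Y: "finite Y" "card Y \<le> d"
  shows "\<exists>\<eta>'. (\<forall>z\<in>Y. \<eta>' z = \<eta> z) \<and> Good r (insert y Y) \<eta>'"
proof -
  obtain X where X: "closure Y X" "bgood (Suc r) X (xsum \<eta>)" using good by (auto simp: Good_def)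
  have "card (insert y Y) \<le> d + 1" using Y by (simp add: card_insert_if)
  then obtain X' where X': "closure (insert y Y) X'" using closure_exists Y(1) by blast
  have cl: "X \<subseteq> V" "X' \<subseteq> V" "card X \<le> d + 1" "card X' \<le> d + 1"
    using closureD[OF X(1)] closureD[OF X'] by blast+
  obtain \<alpha> where \<alpha>: "\<And>x. x \<in> X \<Longrightarrow> \<alpha> x = xsum \<eta> x" "bgood r (X \<union> X') \<alpha>"
    using bgood_extend[OF X(2) cl] by metis
  let ?Q = "X' - X" and ?F = "insert y (Y \<union> nbs X)"
  have finX': "finite X'" using cl finite_V finite_subset by blast
  have "\<exists>\<eta>'. (\<forall>z\<in>?F. \<eta>' z = \<eta> z) \<and> (\<forall>x\<in>?Q. xsum \<eta>' x = \<alpha> x)"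
  proof (rule solve)
    fix Q' assume Q': "Q' \<subseteq> ?Q" "Q' \<noteq> {}"
    have finQ: "finite Q'" using Q' finX' finite_subset by blast
    have "D * card Q' \<le> D * card X'" using Q' finX' by (intro mult_left_mono card_mono) auto
    moreover have "D * card X' \<le> d + 1" using X' unfolding closure_def by (elim conjE)
    ultimately have "D * card Q' \<le> d + 1" by (rule le_trans)
    moreover have "Q' \<subseteq> V - X" using Q' cl by auto
    ultimately have "5 * D * card Q' < card (nbs Q' - (Y \<union> nbs X))"
      using X(1) Q'(2) unfolding closure_def by blast
    \<comment> \<open>\<open>X\<close> is a closure of \<open>Y\<close> without \<open>y\<close>, so
      \<open>y\<close> may cost one neighbour; the gap between \<open>5 * D\<close> and
      \<open>4 * D\<close> absorbs it.\<close>
    also have "\<dots> \<le> card (insert y (nbs Q' - ?F))"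
      using Q' cl finite_nbs[of Q'] by (intro card_mono) auto
    also have "\<dots> \<le> Suc (card (nbs Q' - ?F))" by (rule card_insert_le_m1) auto
    finally have "5 * D * card Q' \<le> card (nbs Q' - ?F)" by simp
    moreover have "0 < D * card Q'" using D Q' finQ by (simp add: card_gt_0_iff)
    ultimately show "4 * D * card Q' < card (nbs Q' - ?F)" by linarith
  qed (use finX' cl in auto)
  then obtain \<eta>' where e': "\<And>z. z \<in> ?F \<Longrightarrow> \<eta>' z = \<eta> z" "\<And>x. x \<in> ?Q \<Longrightarrow> xsum \<eta>' x = \<alpha> x" by blast
  have same: "\<alpha> x = xsum \<eta>' x" if "x \<in> X'" for x
  proof (cases "x \<in> X")
    case True
    have "xsum \<eta>' x = xsum \<eta> x"
      unfolding xsum_def using True by (intro sum.cong e'(1)) (auto simp: nbs_def)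
    then show ?thesis using \<alpha>(1)[OF True] by simp
  next
    case False
    then show ?thesis using e'(2) that by auto
  qed
  have "bgood r X' (xsum \<eta>')"
    by (rule bgood_cong[OF bgood_subset[OF \<alpha>(2) Un_upper2] same])
  then have "Good r (insert y Y) \<eta>'" using X' unfolding Good_def by blast
  then show ?thesis using e'(1) by blast
qed

sublocale duplicator n d R cs Good
proof
  fix L b assume "(L, b) \<in> set cs"
  then show "set L \<subseteq> {..<n div 2}" using cs bcons_V nb_less by fastforce
next
  fix r Y \<eta> L b assume good: "Good r Y \<eta>" and c: "(L, b) \<in> set cs" and L: "set L \<subseteq> Y"
  obtain X where X: "closure Y X" "bgood r X (xsum \<eta>)" using good by (auto simp: Good_def)
  obtain xs where xs: "(xs, b) \<in> bcons" "L = concat (map (\<lambda>x. map (nb x) [0..<8 * D]) xs)"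
    using c cs by auto
  \<comment> \<open>All neighbours of \<open>x\<close> are pebbled here, whereas a vertex outside
    the closure has more than \<open>5 * D\<close> neighbours outside \<open>Y\<close>. Thus the
    circuit strategy sees the whole constraint.\<close>
  have "x \<in> X" if x: "x \<in> set xs" for x
  proof (rule ccontr)
    assume "x \<notin> X"
    moreover have "x \<in> V" using bcons_V[OF xs(1)] x by blast
    ultimately have "{x} \<subseteq> V - X" "{x} \<noteq> {}" "D * card {x} \<le> d + 1" using D by auto
    then have "5 * D * card {x} < card (nbs {x} - (Y \<union> nbs X))"
      using X(1) unfolding closure_def by blast
    moreover have "nbs {x} \<subseteq> set L" using x unfolding xs(2) nbs_def by auto
    with L have "nbs {x} \<subseteq> Y" by blast
    then have "nbs {x} - (Y \<union> nbs X) = {}" by blast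
    ultimately show False by simp
  qed
  then show "(\<Sum>y\<leftarrow>L. \<eta> y) = b"
    unfolding xs(2) sum_concat_nb using bgood_sat[OF X(2) xs(1)] by blast
next
  fix r Y Y' \<eta> assume good: "Good r Y \<eta>" and sub: "Y' \<subseteq> Y"
  then obtain X where X: "closure Y X" "bgood r X (xsum \<eta>)" by (auto simp: Good_def)
  have "card (nbs Q - (Y \<union> nbs X)) \<le> card (nbs Q - (Y' \<union> nbs X))" if "Q \<subseteq> V - X" for Q
    using sub that finite_nbs[of Q] by (intro card_mono) auto
  then have "closure Y' X" using X(1) unfolding closure_def by (meson less_le_trans)
  then show "Good r Y' \<eta>" using X(2) unfolding Good_def by blast
next
  fix r Y \<eta> assume "Good (Suc r) Y \<eta>"
  then obtain X where X: "closure Y X" "bgood (Suc r) X (xsum \<eta>)" by (auto simp: Good_def)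
  then have "X \<subseteq> V" "card X \<le> d + 1" using closureD by blast+
  then obtain \<alpha> where \<alpha>: "\<And>x. x \<in> X \<Longrightarrow> \<alpha> x = xsum \<eta> x" "bgood r (X \<union> {}) \<alpha>"
    using bgood_extend[OF X(2), of "{}"] by (metis card.empty empty_subsetI le0)
  have "bgood r X (xsum \<eta>)" by (rule bgood_cong[OF bgood_subset[OF \<alpha>(2) Un_upper1] \<alpha>(1)])
  then show "Good r Y \<eta>" using X(1) unfolding Good_def by blast
next
  have "closure {} {}"
  proof -
    have "5 * D * card Q < card (nbs Q - ({} \<union> nbs {}))"
      if "Q \<subseteq> V - {}" "Q \<noteq> {}" "D * card Q \<le> d + 1" for Q
    proof -
      have "6 * D * card Q < card (nbs Q)" using expand[of Q] that by (auto simp: nbs_def)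
      then show ?thesis by (simp add: nbs_def)
    qed
    then show ?thesis unfolding closure_def by simp
  qed
  then show "\<exists>\<eta>. Good R {} \<eta>" using bgood_init unfolding Good_def by blast
qed (rule Good_extend)

end

section \<open>Choice of parameters\<close>

lemma power_less_two_power:
  fixes n z :: nat
  assumes "100 * z ^ 2 \<le> n" "2 \<le> n"
  shows "n ^ z < 2 ^ (n - 1)"
proof -
  have n: "0 < real n" "0 < sqrt (real n)" using assms(2) by simp_all
  have "(10 * real z) ^ 2 \<le> real n"
    using assms(1) by (simp add: power_mult_distrib flip: of_nat_le_iff[where 'a = real])
  then have z: "10 * real z \<le> sqrt (real n)" by (rule real_le_rsqrt)
  \<comment> \<open>With \<open>ln n \<le> 2 * sqrt n\<close> the logarithm of \<open>n ^ z\<close>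
    is at most \<open>n / 5\<close>, which is below
    \<open>(n - 1) / 2 \<le> (n - 1) * ln 2\<close>.\<close>
  have "ln (real n) = 2 * ln (sqrt (real n))" using n by (simp add: ln_sqrt)
  also have "\<dots> \<le> 2 * sqrt (real n)" using ln_le_minus_one[OF n(2)] by simp
  finally have "real z * ln (real n) \<le> real z * (2 * sqrt (real n))" by (intro mult_left_mono) auto
  also have "\<dots> \<le> (sqrt (real n) / 10) * (2 * sqrt (real n))"
    using z by (intro mult_right_mono) auto
  also have "\<dots> = real n / 5" by simp
  also have "\<dots> < real (n - 1) * (1 / 2)" using assms(2) by (simp add: of_nat_diff)
  also have "\<dots> \<le> real (n - 1) * ln 2"
    using ln_le_minus_one[of "1 / 2"] by (intro mult_left_mono) (auto simp: ln_div)
  finally have "ln (real n ^ z) < ln (2 ^ (n - 1))" using n by (simp add: ln_realpow)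
  then have "real n ^ z < 2 ^ (n - 1)" using n by (subst (asm) ln_less_cancel_iff) auto
  then show ?thesis by (simp flip: of_nat_less_iff[where 'a = real])
qed

text \<open>\<open>2 * d + 3\<close> exceeds the size of two closures of at most
  \<open>d + 1\<close> vertices, which one answer has to accommodate; \<open>d + 2\<close> in
  \<open>sep_bound\<close> is one closure together with the sink.\<close>

lemma xor_structures_exist:
  fixes n d k D m G R :: nat
  assumes D: "0 < D" "24 * D \<le> k" "k \<le> d" and m: "2 \<le> m" and n: "2 \<le> n"
    and G: "G = (R + 1) * (2 * d + 3)"
    and sep_bound: "G * m * (((G * (m * m) + 1) * m + 1) ^ (d + 2)) ^ 2 < 2 ^ (m - 1)"
    and exp_bound: "2 * ((G * (m * m) + 1) * m) * (6 * (2 * (d + 1))) ^ (8 * D) \<le> (n div 2) ^ (2 * D)"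
  shows "\<exists>cs. kary_structure k (xor_sig cs) (xor_struct n cs False) \<and>
     kary_structure k (xor_sig cs) (xor_struct n cs True) \<and>
     wl_distinguishes (xor_sig cs) k (xor_struct n cs False) (xor_struct n cs True) \<and>
     (\<forall>r. r + d \<le> R \<longrightarrow> \<not> wl_distinguishes_after (xor_sig cs) d r (xor_struct n cs False) (xor_struct n cs True))"
proof -
  have Gpos: "0 < G" using G by simp
  obtain \<omega> where "separating m G (d + 2) \<omega>" using separating_exists[OF _ sep_bound Gpos] m by auto
  then interpret C: circuit m G "2 * d + 3" \<omega> "d + 2" using m by unfold_locales
  let ?S = "G * (m * m)"
  have "card C.V = (?S + 1) * m" by (simp add: C.V_def card_cartesian_product)
  then have "2 * card C.V * (6 * (2 * (d + 1))) ^ (8 * D) \<le> (n div 2) ^ (2 * D)" using exp_bound by simp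
  moreover have "C.V \<noteq> {}" using C.sink_V by blast
  ultimately obtain nb where nb: "\<And>x i. x \<in> C.V \<Longrightarrow> i < 8 * D \<Longrightarrow> nb x i < n div 2"
    and expand: "\<And>S. S \<subseteq> C.V \<Longrightarrow> S \<noteq> {} \<Longrightarrow> D * card S \<le> 2 * (d + 1) \<Longrightarrow>
       6 * D * card S < card ((\<lambda>(x, i). nb x i) ` (S \<times> {..<8 * D}))"
    using expander_exists[OF C.finite_V, of "n div 2" "2 * (d + 1)" D] n by auto
  define nbl where "nbl x = map (nb x) [0..<8 * D]" for x
  define cond where "cond = (\<lambda>(xs, b). (concat (map nbl xs), b :: bit))"
  have "finite (cond ` C.bcons)" by (simp add: C.bcons_def)
  from finite_list[OF this] obtain cs where cs: "set cs = cond ` C.bcons" ..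
  have nbl: "set (nbl x) \<subseteq> {..<n div 2}" if "x \<in> C.V" for x using nb[OF that] by (auto simp: nbl_def)
  interpret K: condensation C.V nb D d R C.bcons C.bgood n cs
  proof
    show "\<exists>\<alpha>'. (\<forall>x\<in>X. \<alpha>' x = \<alpha> x) \<and> C.bgood r (X \<union> X') \<alpha>'"
      if "C.bgood (Suc r) X \<alpha>" "X' \<subseteq> C.V" "card X \<le> d + 1" "card X' \<le> d + 1" for r X \<alpha> X'
      using that card_Un_le[of X X'] by (intro C.bgood_extend) auto
    show "set cs = (\<lambda>(xs, b). (concat (map (\<lambda>x. map (nb x) [0..<8 * D]) xs), b)) ` C.bcons"
      by (simp add: cs cond_def nbl_def[abs_def])
    show "C.bgood R {} \<alpha>" for \<alpha> using G by (intro C.bgood_init) simp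
    show "0 < D" "D \<le> d" using D by simp_all
  qed (fact C.finite_V nb expand C.bcons_V C.bgood_sat C.bgood_subset C.bgood_cong)+
  \<comment> \<open>Layers beyond the last time are empty, so the gate condition is asked only for
    actual steps.\<close>
  define W where "W s = (if s \<le> ?S then {s} \<times> {..<m} else {})" for s
  have W: "x \<in> C.V" if "x \<in> W s" for x s using that by (auto simp: W_def C.V_def split: if_splits)
  interpret S: spoiler n k "8 * D" ?S cs W nbl C.sink
  proof
    fix L b assume "(L, b) \<in> set cs"
    then show "set L \<subseteq> {..<n div 2}" by (rule K.cs_vars)
  next
    fix x assume "x \<in> W 0"
    then obtain j where "j < m" "x = (0, j)" by (auto simp: W_def)
    then have "cond ([x], 0) \<in> set cs" unfolding cs by (intro imageI) (auto simp: C.bcons_def)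
    then show "(nbl x, 0) \<in> set cs" by (simp add: cond_def)
  next
    fix x s assume "x \<in> W (Suc s)"
    then obtain j where j: "j < m" "x = (Suc s, j)" "s < ?S" by (auto simp: W_def split: if_splits)
    then have g: "cond (C.gate s j, 0) \<in> set cs" unfolding cs by (intro imageI) (auto simp: C.bcons_def)
    have s: "(s, i) \<in> W s" if "i < m" for i using j that by (simp add: W_def)
    show "\<exists>x1\<in>W s. (nbl x @ nbl x1, 0) \<in> set cs \<or> (\<exists>x2\<in>W s. (nbl x @ nbl x1 @ nbl x2, 0) \<in> set cs)"
    proof (intro bexI[OF _ s[OF j(1)]])
      have "(s, col m s) \<in> W s" using s m col_less[of m s] by simp
      then show "(nbl x @ nbl (s, j), 0) \<in> set cs \<or> (\<exists>x2\<in>W s. (nbl x @ nbl (s, j) @ nbl x2, 0) \<in> set cs)"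
        using g j(2) by (auto simp: cond_def C.gate_def split: if_splits)
    qed
  next
    show "C.sink \<in> W ?S" using m by (simp add: W_def C.sink_def)
    have "cond ([C.sink], 1) \<in> set cs" unfolding cs by (intro imageI) (auto simp: C.bcons_def)
    then show "(nbl C.sink, 1) \<in> set cs" by (simp add: cond_def)
  qed (use D n nbl W in \<open>auto simp: nbl_def\<close>)
  have "length L \<le> k" if c: "(L, b) \<in> set cs" for L b
  proof -
    obtain xs where xs: "(xs, b) \<in> C.bcons" "L = concat (map nbl xs)"
      using c unfolding cs by (auto simp: cond_def)
    have "length L = length xs * (8 * D)"
      unfolding xs(2) by (induction xs) (auto simp: nbl_def)
    also have "\<dots> \<le> 3 * (8 * D)" using C.length_bcons[OF xs(1)] by (rule mult_right_mono) simp
    finally show ?thesis using D by simp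
  qed
  then have "kary_structure k (xor_sig cs) (xor_struct n cs tw)" for tw by (rule kary_xor_struct)
  then show ?thesis using S.distinguished K.not_distinguished by blast
qed

text \<open>The number of registers is chosen as \<open>n\<close>. The exponent \<open>D - 7\<close>
  leaves seven factors \<open>n\<close>: one each for \<open>R + 1\<close> and
  \<open>2 * d + 3\<close>, two for the steps of a block, one for an added \<open>1\<close>, one for
  the registers and one for a final factor \<open>2\<close>.\<close>

lemma numeric_bounds:
  fixes n d k D :: nat
  assumes k: "500 \<le> k" "k \<le> d" and n: "10 ^ 10 * d ^ 8 * k ^ 6 \<le> n" and D: "D = k div 24"
    and R: "R = n ^ (D - 7)" and G: "G = (R + 1) * (2 * d + 3)"
  shows "G * n * (((G * (n * n) + 1) * n + 1) ^ (d + 2)) ^ 2 < 2 ^ (n - 1)"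
    and "2 * ((G * (n * n) + 1) * n) * (6 * (2 * (d + 1))) ^ (8 * D) \<le> (n div 2) ^ (2 * D)"
proof -
  have D20: "20 \<le> D" "24 * D \<le> k" using k D by auto
  have pos: "1 \<le> d" "1 \<le> k" using k by auto
  have n8: "10 ^ 10 * d ^ 8 \<le> n"
  proof -
    have "10 ^ 10 * d ^ 8 * 1 \<le> 10 ^ 10 * d ^ 8 * k ^ 6" using pos by (intro mult_left_mono) auto
    then show ?thesis using n by linarith
  qed
  have "d ^ 1 \<le> d ^ 8" using pos by (intro power_increasing) auto
  then have nd: "100 * d \<le> n" using n8 by simp
  have n2: "2 \<le> n" using nd pos by linarith
  have step: "2 * n ^ i \<le> n ^ Suc i" for i using n2 by simp
  have one: "1 \<le> n ^ i" for i using n2 by simp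
  have "R + 1 \<le> n ^ (D - 6)"
  proof -
    have eq: "D - 6 = Suc (D - 7)" using D20 by simp
    show ?thesis using step[of "D - 7"] one[of "D - 7"] unfolding R eq by linarith
  qed
  moreover have "2 * d + 3 \<le> n" using nd pos by linarith
  ultimately have "G \<le> n ^ (D - 6) * n" unfolding G by (rule mult_le_mono)
  also have "\<dots> = n ^ (D - 5)"
  proof -
    have "D - 5 = Suc (D - 6)" using D20 by simp
    then show ?thesis by simp
  qed
  finally have G1: "G \<le> n ^ (D - 5)" .
  have V1: "(G * (n * n) + 1) * n \<le> n ^ (D - 1)"
  proof -
    have "G * (n * n) \<le> n ^ (D - 5) * (n * n)" using G1 by (rule mult_right_mono) simp
    also have "\<dots> = n ^ (D - 3)"
    proof -
      have "D - 3 = Suc (Suc (D - 5))" using D20 by simp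
      then show ?thesis by simp
    qed
    finally have "G * (n * n) + 1 \<le> 2 * n ^ (D - 3)" using one[of "D - 3"] by linarith
    also have "\<dots> \<le> n ^ (D - 2)"
    proof -
      have eq: "D - 2 = Suc (D - 3)" using D20 by simp
      show ?thesis unfolding eq by (rule step)
    qed
    finally have "(G * (n * n) + 1) * n \<le> n ^ (D - 2) * n" by (rule mult_right_mono) simp
    also have "\<dots> = n ^ (D - 1)"
    proof -
      have "D - 1 = Suc (D - 2)" using D20 by simp
      then show ?thesis by simp
    qed
    finally show ?thesis .
  qed
  have "Suc (D - 1) = D" using D20 by simp
  with step[of "D - 1"] have top: "2 * n ^ (D - 1) \<le> n ^ D" by (simp only:)
  have V2: "(G * (n * n) + 1) * n + 1 \<le> n ^ D" using V1 one[of "D - 1"] top by linarith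
  have V3: "2 * ((G * (n * n) + 1) * n) \<le> n ^ D" using V1 top by linarith
  have G2: "G * n \<le> n ^ D"
  proof -
    have "G * n \<le> n ^ (D - 5) * n" using G1 by (rule mult_right_mono) simp
    also have "\<dots> = n ^ Suc (D - 5)" by simp
    also have "\<dots> \<le> n ^ D" using n2 D20 by (intro power_increasing) auto
    finally show ?thesis .
  qed
  have "G * n * (((G * (n * n) + 1) * n + 1) ^ (d + 2)) ^ 2 \<le> n ^ D * ((n ^ D) ^ (d + 2)) ^ 2"
    using G2 V2 by (intro mult_le_mono power_mono) auto
  also have "\<dots> = n ^ (D + D * (d + 2) * 2)" by (simp only: power_add power_mult)
  also have "\<dots> \<le> n ^ (k * d)"
  proof (rule power_increasing)
    have "D + D * (d + 2) * 2 = D * (2 * d + 5)" by (simp add: algebra_simps)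
    also have "\<dots> \<le> D * (24 * d)" using k by (intro mult_left_mono) auto
    also have "\<dots> = (24 * D) * d" by simp
    also have "\<dots> \<le> k * d" using D20 by (intro mult_right_mono) auto
    finally show "D + D * (d + 2) * 2 \<le> k * d" .
  qed (use n2 in simp)
  also have "\<dots> < 2 ^ (n - 1)"
  proof (rule power_less_two_power)
    have "d ^ 2 \<le> d ^ 8" "k ^ 2 \<le> k ^ 6" using pos by (auto intro!: power_increasing)
    then have "10 ^ 10 * d ^ 2 * k ^ 2 \<le> 10 ^ 10 * d ^ 8 * k ^ 6" by (intro mult_le_mono) auto
    moreover have "100 * (k * d) ^ 2 \<le> 10 ^ 10 * (d ^ 2 * k ^ 2)"
      unfolding power_mult_distrib by (simp add: mult.commute)
    ultimately show "100 * (k * d) ^ 2 \<le> n" using n by (simp add: mult.assoc)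
  qed (rule n2)
  finally show "G * n * (((G * (n * n) + 1) * n + 1) ^ (d + 2)) ^ 2 < 2 ^ (n - 1)" .
  \<comment> \<open>With \<open>12 * (d + 1) \<le> 13 * d\<close> and
    \<open>n \<le> 3 * (n div 2)\<close> it is enough that
    \<open>9 * 13 ^ 8 * d ^ 8 \<le> n\<close>; the constant \<open>10 ^ 10\<close> exceeds
    \<open>9 * 13 ^ 8\<close>.\<close>
  have half: "n * (6 * (2 * (d + 1))) ^ 8 \<le> (n div 2) ^ 2"
  proof -
    have "(6 * (2 * (d + 1))) ^ 8 \<le> (13 * d) ^ 8" using k by (intro power_mono) auto
    also have "\<dots> = 815730721 * d ^ 8" by (simp add: power_mult_distrib)
    finally have "9 * (6 * (2 * (d + 1))) ^ 8 \<le> n" using n8 by simp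
    then have "n * (9 * (6 * (2 * (d + 1))) ^ 8) \<le> n * n" by (rule mult_left_mono) simp
    moreover have "n * n \<le> 9 * (n div 2) ^ 2"
    proof -
      have "n \<le> 3 * (n div 2)" using nd pos by linarith
      then have "n * n \<le> (3 * (n div 2)) * (3 * (n div 2))" by (intro mult_le_mono)
      then show ?thesis by (simp add: power2_eq_square)
    qed
    ultimately show ?thesis by linarith
  qed
  have "2 * ((G * (n * n) + 1) * n) * (6 * (2 * (d + 1))) ^ (8 * D) \<le> n ^ D * (6 * (2 * (d + 1))) ^ (8 * D)"
    using V3 by (rule mult_right_mono) simp
  also have "\<dots> = (n * (6 * (2 * (d + 1))) ^ 8) ^ D" by (simp only: power_mult power_mult_distrib)
  also have "\<dots> \<le> ((n div 2) ^ 2) ^ D" using half by (rule power_mono) simp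
  also have "\<dots> = (n div 2) ^ (2 * D)" by (simp only: power_mult)
  finally show "2 * ((G * (n * n) + 1) * n) * (6 * (2 * (d + 1))) ^ (8 * D) \<le> (n div 2) ^ (2 * D)" .
qed

theorem theorem1p2:
  "\<exists>(k0::nat) (\<alpha>::real) (\<epsilon>::real). \<alpha> > 0 \<and> \<epsilon> > 0 \<and>
     (\<forall>(d::nat) (k::nat) (n::nat).
        k0 \<le> k \<longrightarrow> k \<le> d \<longrightarrow> real n \<ge> \<alpha> * real d ^ 8 * real k ^ 6 \<longrightarrow>
        (\<exists>(\<sigma>::signature) (A::nat rel_struct) (B::nat rel_struct).
           kary_structure k \<sigma> A \<and> kary_structure k \<sigma> B \<and>
           card (univ A) = n \<and> card (univ B) = n \<and>
           wl_distinguishes \<sigma> k A B \<and>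
           (\<forall>r::nat. real r \<le> real n powr (\<epsilon> * real k) \<longrightarrow>
              \<not> wl_distinguishes_after \<sigma> d r A B)))"
proof (rule exI[of _ 500], rule exI[of _ "10 ^ 10"], rule exI[of _ "1 / 100"], intro conjI allI impI)
  fix d k n :: nat
  assume k: "500 \<le> k" "k \<le> d" and nr: "10 ^ 10 * real d ^ 8 * real k ^ 6 \<le> real n"
  define D where "D = k div 24"
  define R where "R = n ^ (D - 7)"
  define G where "G = (R + 1) * (2 * d + 3)"
  have "real (10 ^ 10 * d ^ 8 * k ^ 6) \<le> real n" using nr by simp
  then have n: "10 ^ 10 * d ^ 8 * k ^ 6 \<le> n" by (simp only: of_nat_le_iff)
  have D20: "20 \<le> D" "24 * D \<le> k" "k \<le> 24 * D + 23" using k by (auto simp: D_def)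
  have dn: "d \<le> n" "2 \<le> n"
  proof -
    have "d ^ 1 \<le> d ^ 8" using k by (intro power_increasing) auto
    then have "1 * d * 1 \<le> 10 ^ 10 * d ^ 8 * k ^ 6" using k by (intro mult_le_mono) auto
    then show "d \<le> n" "2 \<le> n" using n k by linarith+
  qed
  have "0 < D" using D20 by simp
  from xor_structures_exist[OF this D20(2) k(2) dn(2) dn(2) G_def numeric_bounds[OF k n D_def R_def G_def]]
  obtain cs where cs: "kary_structure k (xor_sig cs) (xor_struct n cs False)"
     "kary_structure k (xor_sig cs) (xor_struct n cs True)"
     "wl_distinguishes (xor_sig cs) k (xor_struct n cs False) (xor_struct n cs True)"
     "\<And>r. r + d \<le> R \<Longrightarrow> \<not> wl_distinguishes_after (xor_sig cs) d r (xor_struct n cs False) (xor_struct n cs True)"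
    by blast
  \<comment> \<open>The \<open>d\<close> rounds spent on the bijection of tuples at most double the
    bound, and one more factor \<open>n\<close> covers this.\<close>
  have "r + d \<le> R" if r: "real r \<le> real n powr (1 / 100 * real k)" for r
  proof -
    have n1: "1 \<le> real n" "0 < real n" using dn by simp_all
    have "real d \<le> real n powr 1" using dn n1 by simp
    also have "\<dots> \<le> real n powr (1 / 100 * real k)" using n1 k by (intro powr_mono) auto
    finally have "real r + real d \<le> 2 * real n powr (1 / 100 * real k)" using r by simp
    also have "\<dots> \<le> real n powr 1 * real n powr (1 / 100 * real k)"
      using dn by (intro mult_right_mono) auto
    also have "\<dots> = real n powr (1 + 1 / 100 * real k)" by (simp only: powr_add)
    also have "\<dots> \<le> real n powr real (D - 7)"
    \<comment> \<open>Since \<open>D \<ge> (k - 23) / 24\<close>, the slope \<open>1 / 24\<close>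
      beats \<open>1 / 100\<close>, and \<open>k \<ge> 500\<close> covers the additive
      constants.\<close>
    proof (rule powr_mono)
      have "real k \<le> 24 * real D + 23" using D20(3) by linarith
      moreover have "500 \<le> real k" using k by simp
      moreover have "real (D - 7) = real D - 7" using D20 by simp
      ultimately show "1 + 1 / 100 * real k \<le> real (D - 7)" by linarith
    qed (use n1 in simp)
    also have "\<dots> = real R" using n1 by (simp add: powr_realpow R_def)
    finally show ?thesis by linarith
  qed
  then show "\<exists>\<sigma> (A::nat rel_struct) (B::nat rel_struct).
       kary_structure k \<sigma> A \<and> kary_structure k \<sigma> B \<and>
       card (univ A) = n \<and> card (univ B) = n \<and> wl_distinguishes \<sigma> k A B \<and>
       (\<forall>r::nat. real r \<le> real n powr (1 / 100 * real k) \<longrightarrow> \<not> wl_distinguishes_after \<sigma> d r A B)"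
    using cs by (intro exI[of _ "xor_sig cs"] exI[of _ "xor_struct n cs False"] exI[of _ "xor_struct n cs True"]) auto
qed simp_all

end
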